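(* Let $\mu>0$, let $\eta:[0,1]\to[0,1]$ be continuous and strictly decreasing with $\eta(0)=1$, $\eta(1)=0$, and let $J$ be the CDF of a probability distribution on $[0,\infty)$ such that, for some integer $\ell\ge 2$, $$m^{(k)}:=\int_0^\infty y^k\,dJ(y)<\infty,\qquad k=1,\dots,\ell,$$ and $m^{(1)}>0$. Then: (i) There exists a traveling wave shape $\phi(\cdot)$. (ii) Any traveling wave shape $\phi(\cdot)$ satisfies $$\int_{\mathbb{R}}|y|^{\ell-1}\,d\phi(y)<\infty .$$
   Context: RCLL means right-continuous with left limits. A distribution function is a non-decreasing RCLL function $\gamma:\mathbb{R}\to[0,1]$ with limits $0$ at $-\infty$ and $1$ at $+\infty$. Write $\bar J(y)=1-J(y)$. For a distribution function $\gamma$ and $y\in\mathbb{R}$, set $\bar\eta(y,\gamma)=\eta(\gamma(y))$ if $\gamma$ is continuous at $y$, and otherwise $$\bar\eta(y,\gamma)=\frac{1}{\nu_2-\nu_1}\int_{\nu_1}^{\nu_2}\eta(\nu)\,d\nu,\qquad \nu_1=\gamma(y-),\ \nu_2=\gamma(y).$$ Mean-field model: a function $f(x,t)$, $x\in\mathbb{R}$, $t\ge0$, such that (a) for each $t$, $f(\cdot,t)$ is a distribution function; (b) for each $x$, $f(x,\cdot)$ is non-increasing and $c$-Lipschitz in $t$, with a constant $c$ independent of $x$; (c) for each $x$ and each $t$ at which $\frac{\partial}{\partial t}f(x,t)$ exists, $$\frac{\partial}{\partial t}f(x,t)=-\mu\int_{(-\infty,x]}\bar\eta(y,f(\cdot,t))\,\bar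 J(x-y)\,d_yf(y,t),$$ where $d_y$ denotes the (Stieltjes) differential in $y$. Let $v=\mu\, m^{(1)}\int_0^1\eta(\nu)\,d\nu$. A traveling wave shape is a distribution function $\phi$ such that $f(x,t)=\phi(x-vt)$ is a mean-field model. *)

theory Defs
  imports "HOL-Probability.Probability"
begin

definition rcll :: "(real \<Rightarrow> real) \<Rightarrow> bool" where
  "rcll g \<longleftrightarrow> (\<forall>x. continuous (at_right x) g \<and> (\<exists>l. (g \<longlongrightarrow> l) (at_left x)))"

definition distribution_function :: "(real \<Rightarrow> real) \<Rightarrow> bool" where
  "distribution_function g \<longleftrightarrow>
     mono g \<and> rcll g \<and> (\<forall>x. g x \<in> {0..1}) \<and>
     (g \<longlongrightarrow> 0) at_bot \<and> (g \<longlongrightarrow> 1) at_top"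

definition cdf_on_nonneg :: "(real \<Rightarrow> real) \<Rightarrow> bool" where
  "cdf_on_nonneg J \<longleftrightarrow> (\<exists>M. real_distribution M \<and> measure M {0..} = 1 \<and> J = cdf M)"

text \<open>
  Stieltjes integrals with respect to a distribution function \<open>g\<close> are Lebesgue integrals with
  respect to \<^const>\<open>interval_measure\<close> \<open>g\<close>, the measure giving each interval \<open>(a, b]\<close> the mass
  \<open>g b - g a\<close>.
\<close>

definition has_moment :: "(real \<Rightarrow> real) \<Rightarrow> nat \<Rightarrow> bool" where
  "has_moment J k \<longleftrightarrow> set_integrable (interval_measure J) {0..} (\<lambda>y. y ^ k)"

definition moment :: "(real \<Rightarrow> real) \<Rightarrow> nat \<Rightarrow> real" where
  "moment J k = (LINT y:{0..}|interval_measure J. y ^ k)"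

definition eta_bar :: "(real \<Rightarrow> real) \<Rightarrow> real \<Rightarrow> (real \<Rightarrow> real) \<Rightarrow> real" where
  "eta_bar \<eta> y g =
     (if isCont g y then \<eta> (g y)
      else let \<nu>1 = Lim (at_left y) g; \<nu>2 = g y
           in 1 / (\<nu>2 - \<nu>1) * integral {\<nu>1..\<nu>2} \<eta>)"

text \<open>
  Time ranges over \<open>[0, \<infinity>)\<close>; the values \<open>f x t\<close> with \<open>t < 0\<close> are irrelevant. Accordingly the time
  derivative is taken within \<open>[0, \<infinity>)\<close>: it is the usual derivative for \<open>t > 0\<close> and the right
  derivative at \<open>t = 0\<close>.
\<close>

definition mean_field_model ::
  "real \<Rightarrow> (real \<Rightarrow> real) \<Rightarrow> (real \<Rightarrow> real) \<Rightarrow> (real \<Rightarrow> real \<Rightarrow> real) \<Rightarrow> bool" where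
  "mean_field_model \<mu> \<eta> J f \<longleftrightarrow>
     (\<forall>t\<ge>0. distribution_function (\<lambda>x. f x t)) \<and>
     (\<exists>c. \<forall>x. antimono_on {0..} (f x) \<and> c-lipschitz_on {0..} (f x)) \<and>
     (\<forall>x. \<forall>t\<ge>0. \<forall>D. (f x has_real_derivative D) (at t within {0..}) \<longrightarrow>
        D = - \<mu> * (LINT y:{..x}|interval_measure (\<lambda>y. f y t).
                     eta_bar \<eta> y (\<lambda>x. f x t) * (1 - J (x - y))))"

definition wave_speed :: "real \<Rightarrow> (real \<Rightarrow> real) \<Rightarrow> (real \<Rightarrow> real) \<Rightarrow> real" where
  "wave_speed \<mu> \<eta> J = \<mu> * moment J 1 * integral {0..1} \<eta>"

definition traveling_wave_shape ::
  "real \<Rightarrow> (real \<Rightarrow> real) \<Rightarrow> (real \<Rightarrow> real) \<Rightarrow> (real \<Rightarrow> real) \<Rightarrow> bool" where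
  "traveling_wave_shape \<mu> \<eta> J \<phi> \<longleftrightarrow>
     distribution_function \<phi> \<and>
     mean_field_model \<mu> \<eta> J (\<lambda>x t. \<phi> (x - wave_speed \<mu> \<eta> J * t))"

end

theory Submission
  imports Defs
begin

text \<open>
  The theorem is about one fixed-point equation. Put \<open>H u = \<integral>\<^sub>0\<^sup>u \<eta>\<close> and \<open>h u = H u / H 1\<close>, and let \<open>N\<close>
  be the law with density \<open>(1 - J z) / m\<close> on \<open>[0, \<infinity>)\<close>, where \<open>m\<close> is the mean of \<open>J\<close>. A distribution
  function \<open>\<phi>\<close> is a traveling wave shape if and only if it is continuous and
  \<open>\<phi> x = \<integral> h (\<phi> (x - z)) dN z\<close> for all \<open>x\<close>. Indeed, a shape inherits a Lipschitz bound from the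
  Lipschitz bound in time, so \<open>\<eta> (\<phi> y) d\<phi> y\<close> is the Stieltjes differential of \<open>H \<circ> \<phi>\<close>, and the
  equation of the model reads \<open>v \<phi>' x = \<mu> \<integral> (1 - J (x - y)) d(H \<circ> \<phi>) y\<close> over \<open>y \<le> x\<close>. Integrating
  in \<open>x\<close> and exchanging the integrals gives the fixed-point equation, and the value of \<open>v\<close> is exactly
  the one for which \<open>h\<close> and \<open>N\<close> are normalised (\<open>nn_integral_flux\<close>). The right-hand side is continuous
  in \<open>x\<close>, so a fixed point is continuously differentiable and satisfies the equation everywhere
  (\<open>fixed_point_derivative\<close>). In the other direction the equation is known only where the derivative
  exists; this suffices, since a Lipschitz function is the integral of its left derivative, which
  exists almost everywhere (\<open>lipschitz_cdf_density\<close>, \<open>fixed_point_if_left_derivative\<close>).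

  As \<open>\<eta>\<close> decreases strictly, \<open>h\<close> is concave with \<open>h u > u\<close> on \<open>(0, 1)\<close>, so the equation describes a
  stationary front that connects the unstable state 0 with the stable state 1 of a monostable
  recursion. For existence, suppose that \<open>h u = c u\<close> for \<open>u \<le> \<epsilon>\<close>. Let \<open>r\<close> solve \<open>c E exp (- r Z) = 1\<close>,
  where \<open>Z\<close> has law \<open>N\<close>. Because \<open>Z \<ge> 0\<close>, the function \<open>exp (r x)\<close> reproduces itself as long as it is
  below \<open>\<epsilon>\<close>, so \<open>min \<epsilon> (exp (r x))\<close> is a subsolution, \<open>min 1 (exp (r x))\<close> is a supersolution, and
  monotone iteration yields a fixed point between them (\<open>fixed_point_if_linear_near_0\<close>). A general \<open>h\<close>
  is approximated by \<open>min (c u) (h u)\<close> with \<open>c = h \<epsilon> / \<epsilon>\<close>; the fixed points, translated to take the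
  value \<open>1 / 2\<close> at 0, have a limit by Helly's selection theorem, and this normalisation prevents the
  limit from being constant (\<open>fixed_point_exists\<close>).

  For the moments, the slope of \<open>h\<close> near 0 exceeds 1, which makes the left tail decay geometrically
  (\<open>left_tail_geometric\<close>). Near 1 the slope of \<open>h\<close> tends to 0, so \<open>1 - \<phi>\<close> satisfies a renewal inequality
  with arbitrarily small mass whose inhomogeneity is the tail of \<open>N\<close>; hence \<open>\<phi>\<close> has as many moments on
  the right as \<open>N\<close> (\<open>right_tail\<close>), which is one less than \<open>J\<close> (\<open>nn_integral_weight_N\<close>).
\<close>

section \<open>Convolution with an atomless law\<close>

lemma (in finite_borel_measure) AE_isCont_reflect:
  assumes atomless: "\<And>z. measure M {z} = 0"
    and "countable {u. \<not> isCont (g :: real \<Rightarrow> real) u}"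
  shows "AE y in M. isCont g (x - y)"
proof -
  have "countable ((\<lambda>u. x - u) ` {u. \<not> isCont g u})" using assms(2) by simp
  moreover have "{z} \<in> null_sets M" for z
    using atomless[of z] by (auto simp: null_sets_def emeasure_eq_measure)
  ultimately have "(\<Union>z\<in>(\<lambda>u. x - u) ` {u. \<not> isCont g u}. {z}) \<in> null_sets M"
    by (intro null_sets_UN') auto
  then show ?thesis
  proof (rule AE_I')
    show "{y \<in> space M. \<not> isCont g (x - y)} \<subseteq> (\<Union>z\<in>(\<lambda>u. x - u) ` {u. \<not> isCont g u}. {z})"
    proof
      fix y assume "y \<in> {y \<in> space M. \<not> isCont g (x - y)}"
      then have "y = x - (x - y)" "\<not> isCont g (x - y)" by auto
      then show "y \<in> (\<Union>z\<in>(\<lambda>u. x - u) ` {u. \<not> isCont g u}. {z})" by blast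
    qed
  qed
qed

text \<open>
  An atomless measure almost never meets one of the countably many jumps of the reflected function,
  so dominated convergence applies. The weight \<open>w\<close> will be \<open>\<eta>\<close> along a wave shape.
\<close>

lemma (in finite_borel_measure) isCont_convolution:
  fixes g :: "real \<Rightarrow> real"
  assumes atomless: "\<And>z. measure M {z} = 0"
    and disc: "countable {u. \<not> isCont g u}"
    and [measurable]: "g \<in> borel_measurable borel" "w \<in> borel_measurable borel"
    and bound: "\<And>u. \<bar>g u\<bar> \<le> B" "\<And>u. \<bar>w u\<bar> \<le> C"
  shows "isCont (\<lambda>x. \<integral>y. w y * g (x - y) \<partial>M) x"
proof (rule continuous_at_sequentiallyI)
  fix u assume u: "u \<longlonglongrightarrow> x"
  have [measurable_cong]: "sets M = sets borel" by (rule M_is_borel)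
  show "(\<lambda>n. \<integral>y. w y * g (u n - y) \<partial>M) \<longlonglongrightarrow> (\<integral>y. w y * g (x - y) \<partial>M)"
  proof (rule integral_dominated_convergence[where w="\<lambda>_. C * B"])
    show "AE y in M. (\<lambda>n. w y * g (u n - y)) \<longlonglongrightarrow> w y * g (x - y)"
      using AE_isCont_reflect[OF atomless disc, of x]
    proof eventually_elim
      case (elim y)
      show ?case
        by (intro tendsto_intros isCont_tendsto_compose[OF elim] u)
    qed
    have "0 \<le> C" using bound(2)[of 0] by linarith
    then show "AE y in M. norm (w y * g (u n - y)) \<le> C * B" for n
      using bound by (auto simp: abs_mult intro!: AE_I2 mult_mono)
  qed auto
qed

section \<open>The fixed-point equation\<close>

definition unit_mono :: "(real \<Rightarrow> real) \<Rightarrow> bool" where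
  "unit_mono g \<longleftrightarrow> mono g \<and> (\<forall>x. g x \<in> {0..1})"

text \<open>
  The nonlinearity of a recursion whose constant states 0 and 1 are unstable and stable; only its
  values on \<open>[0, 1]\<close> matter.
\<close>

definition monostable :: "(real \<Rightarrow> real) \<Rightarrow> bool" where
  "monostable h \<longleftrightarrow> mono_on {0..1} h \<and> continuous_on {0..1} h \<and> h 0 = 0 \<and> h 1 = 1 \<and>
     (\<forall>u. 0 < u \<and> u < 1 \<longrightarrow> u < h u)"

lemma unit_monoD: "unit_mono g \<Longrightarrow> mono g" "unit_mono g \<Longrightarrow> 0 \<le> g x" "unit_mono g \<Longrightarrow> g x \<le> 1"
  by (auto simp: unit_mono_def)

lemma unit_mono_abs: "unit_mono g \<Longrightarrow> \<bar>g x\<bar> \<le> 1"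
  using unit_monoD(2,3)[of g x] by auto

lemma unit_mono_measurable: "unit_mono g \<Longrightarrow> g \<in> borel_measurable borel"
  by (intro borel_measurable_mono unit_monoD)

lemma unit_mono_tendsto_at_top:
  assumes "unit_mono g"
  shows "\<exists>b. (g \<longlongrightarrow> b) at_top \<and> (\<forall>x. g x \<le> b)"
proof (intro exI conjI allI)
  have bdd: "bdd_above (range g)" by (rule bdd_aboveI[of _ 1]) (auto simp: unit_monoD[OF assms])
  show le: "g x \<le> Sup (range g)" for x by (rule cSup_upper[OF _ bdd]) auto
  show "(g \<longlongrightarrow> Sup (range g)) at_top"
  proof (rule order_tendstoI)
    fix y assume "y < Sup (range g)"
    then obtain x where "y < g x" using less_cSup_iff[OF _ bdd] by auto
    then show "\<forall>\<^sub>F x in at_top. y < g x"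
      by (auto simp: eventually_at_top_linorder intro!: exI[of _ x] dest: monoD[OF unit_monoD(1)[OF assms]])
  next
    fix y assume "Sup (range g) < y"
    then show "\<forall>\<^sub>F x in at_top. g x < y" by (intro always_eventually allI le_less_trans[OF le])
  qed
qed

lemma unit_mono_limits:
  assumes "unit_mono g"
  shows "\<exists>b. (g \<longlongrightarrow> b) at_top \<and> (\<forall>x. g x \<le> b)" "\<exists>a. (g \<longlongrightarrow> a) at_bot \<and> (\<forall>x. a \<le> g x)"
proof -
  show "\<exists>b. (g \<longlongrightarrow> b) at_top \<and> (\<forall>x. g x \<le> b)" by (rule unit_mono_tendsto_at_top[OF assms])
  have "unit_mono (\<lambda>x. 1 - g (- x))"
    using assms by (auto simp: unit_mono_def mono_def)
  from unit_mono_tendsto_at_top[OF this] obtain b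
    where b: "((\<lambda>x. 1 - g (- x)) \<longlongrightarrow> b) at_top" "\<And>x. 1 - g (- x) \<le> b" by blast
  have "((\<lambda>x. 1 - (1 - g (- x))) \<longlongrightarrow> 1 - b) at_top" by (intro tendsto_intros b(1))
  then have "(g \<longlongrightarrow> 1 - b) at_bot" by (simp add: filterlim_at_bot_mirror)
  moreover have "1 - b \<le> g x" for x using b(2)[of "-x"] by simp
  ultimately show "\<exists>a. (g \<longlongrightarrow> a) at_bot \<and> (\<forall>x. a \<le> g x)" by blast
qed

lemma unit_mono_shift: "unit_mono g \<Longrightarrow> unit_mono (\<lambda>x. g (x + a))"
  by (auto simp: unit_mono_def mono_def)

lemma monostable_mono: "monostable h \<Longrightarrow> 0 \<le> u \<Longrightarrow> u \<le> v \<Longrightarrow> v \<le> 1 \<Longrightarrow> h u \<le> h v"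
  by (auto simp: monostable_def mono_on_def)

lemma monostable_range: "monostable h \<Longrightarrow> 0 \<le> u \<Longrightarrow> u \<le> 1 \<Longrightarrow> 0 \<le> h u \<and> h u \<le> 1"
  using monostable_mono[of h 0 u] monostable_mono[of h u 1] by (auto simp: monostable_def)

lemma monostable_gt: "monostable h \<Longrightarrow> 0 < u \<Longrightarrow> u < 1 \<Longrightarrow> u < h u"
  by (simp add: monostable_def)

lemma monostable_0: "monostable h \<Longrightarrow> h 0 = 0"
  by (simp add: monostable_def)

lemma monostable_tendsto:
  assumes "monostable h" "(f \<longlongrightarrow> a) F" "0 \<le> a" "a \<le> 1" "\<And>x. 0 \<le> f x \<and> f x \<le> 1"
  shows "((\<lambda>x. h (f x)) \<longlongrightarrow> h a) F"
  using assms unfolding monostable_def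
  by (intro continuous_on_tendsto_compose[of "{0..1}" h f a F]) auto

lemma monostable_fixed_point:
  assumes "monostable h" "h u = u" "0 \<le> u" "u \<le> 1"
  shows "u = 0 \<or> u = 1"
proof (rule ccontr)
  assume "\<not> (u = 0 \<or> u = 1)"
  with assms(3,4) have "0 < u" "u < 1" by auto
  with assms(1) have "u < h u" by (auto simp: monostable_def)
  with assms(2) show False by simp
qed

lemma unit_mono_comp:
  assumes h: "monostable h" and g: "unit_mono g"
  shows "unit_mono (\<lambda>x. h (g x))"
  unfolding unit_mono_def
proof (intro conjI allI monoI)
  fix x y :: real assume "x \<le> y"
  then show "h (g x) \<le> h (g y)"
    by (intro monostable_mono[OF h] monoD[OF unit_monoD(1)[OF g]] unit_monoD(2,3)[OF g])
next
  fix x show "h (g x) \<in> {0..1}"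
    using monostable_range[OF h unit_monoD(2,3)[OF g]] by simp
qed

text \<open>
  The ratio \<open>h u / u\<close> is non-increasing, without a division. This consequence of concavity compares \<open>h\<close>
  with its chords through the origin.
\<close>

definition star_shaped :: "(real \<Rightarrow> real) \<Rightarrow> bool" where
  "star_shaped h \<longleftrightarrow> (\<forall>u v. 0 < u \<and> u \<le> v \<and> v \<le> 1 \<longrightarrow> u * h v \<le> v * h u)"

lemma star_shapedD: "star_shaped h \<Longrightarrow> 0 < u \<Longrightarrow> u \<le> v \<Longrightarrow> v \<le> 1 \<Longrightarrow> u * h v \<le> v * h u"
  by (simp add: star_shaped_def)

text \<open>
  The law of the displacement in the fixed-point equation. Without atoms it turns every bounded
  monotone function into a continuous one.
\<close>

locale jump_law = real_distribution N for N :: "real measure" +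
  assumes atomless: "measure N {z} = 0"
    and nonneg: "AE z in N. 0 \<le> z"
begin

definition evolve :: "(real \<Rightarrow> real) \<Rightarrow> (real \<Rightarrow> real) \<Rightarrow> real \<Rightarrow> real" where
  "evolve h g x = (\<integral>z. h (g (x - z)) \<partial>N)"

lemma evolve_isCont:
  assumes "monostable h" "unit_mono g"
  shows "isCont (evolve h g) x"
proof -
  note k = unit_mono_comp[OF assms]
  have "isCont (\<lambda>x. \<integral>y. 1 * h (g (x - y)) \<partial>N) x"
    by (rule isCont_convolution[where g="\<lambda>x. h (g x)" and B=1 and C=1])
      (auto simp: atomless mono_ctble_discont[OF unit_monoD(1)[OF k]] unit_mono_measurable[OF k] unit_mono_abs[OF k])
  then show ?thesis by (simp add: evolve_def[abs_def])
qed

lemma evolve_integrable: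
  assumes "monostable h" "unit_mono g"
  shows "integrable N (\<lambda>z. h (g (x - z)))"
proof -
  note k = unit_mono_comp[OF assms]
  note [measurable] = unit_mono_measurable[OF k]
  show ?thesis
    by (rule integrable_const_bound[where B=1])
      (auto simp: unit_mono_abs[OF k])
qed

lemma evolve_le:
  assumes "monostable h" "unit_mono g" "unit_mono g'" "\<And>u. g u \<le> g' u"
  shows "evolve h g x \<le> evolve h g' x"
  unfolding evolve_def
proof (rule integral_mono)
  show "h (g (x - z)) \<le> h (g' (x - z))" for z
    by (intro monostable_mono[OF assms(1)] assms(4) unit_monoD(2,3)[OF assms(2)] unit_monoD(2,3)[OF assms(3)])
qed (rule evolve_integrable[OF assms(1,2)] evolve_integrable[OF assms(1,3)])+

lemma evolve_unit_mono:
  assumes "monostable h" "unit_mono g"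
  shows "unit_mono (evolve h g)"
  unfolding unit_mono_def
proof (intro conjI allI monoI)
  note k = unit_mono_comp[OF assms]
  fix x y :: real assume "x \<le> y"
  then show "evolve h g x \<le> evolve h g y" unfolding evolve_def
    by (intro integral_mono evolve_integrable[OF assms] monoD[OF unit_monoD(1)[OF k]]) simp
next
  note k = unit_mono_comp[OF assms]
  fix x
  have "evolve h g x \<le> 1" unfolding evolve_def
    by (intro integral_le_const evolve_integrable[OF assms] AE_I2 unit_monoD(3)[OF k])
  moreover have "evolve h g x \<ge> 0" unfolding evolve_def
    by (intro integral_nonneg_AE AE_I2 unit_monoD(2)[OF k])
  ultimately show "evolve h g x \<in> {0..1}" by auto
qed

text \<open>
  Letting the nonlinearity, the function and the point vary together covers monotone iteration, the
  approximation of the nonlinearity and the limits at infinity.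
\<close>

lemma evolve_tendsto:
  assumes "\<And>n. monostable (hs n)" "\<And>n. unit_mono (gs n)" "f \<in> borel_measurable borel"
    and "AE z in N. (\<lambda>n. hs n (gs n (xs n - z))) \<longlonglongrightarrow> f z"
  shows "(\<lambda>n. evolve (hs n) (gs n) (xs n)) \<longlonglongrightarrow> (\<integral>z. f z \<partial>N)"
  unfolding evolve_def
proof (rule integral_dominated_convergence[where w="\<lambda>_. 1"])
  note k = unit_mono_comp[OF assms(1,2)]
  show "AE z in N. norm (hs n (gs n (xs n - z))) \<le> 1" for n
    by (auto simp: unit_mono_abs[OF k])
  note [measurable] = unit_mono_measurable[OF k]
  show "(\<lambda>z. hs n (gs n (xs n - z))) \<in> borel_measurable N" for n by simp
qed (use assms in auto)

text \<open>
  Passing to the limit under the integral shows that \<open>a\<close> is a fixed point of \<open>h\<close>. The sequence \<open>X\<close>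
  makes dominated convergence for sequences applicable at both ends of the line.
\<close>

lemma fixed_point_limit:
  assumes h: "monostable h" and g: "unit_mono g" and fp: "\<And>x. evolve h g x = g x"
    and X: "filterlim X F sequentially" and lim: "(g \<longlongrightarrow> a) F" "F = at_top \<or> F = at_bot"
  shows "a = 0 \<or> a = 1"
proof -
  have a: "0 \<le> a" "a \<le> 1"
    using lim(2) tendsto_lowerbound[OF lim(1)] tendsto_upperbound[OF lim(1)]
    by (auto simp: unit_monoD[OF g])
  have 1: "filterlim (\<lambda>n. X n - z) F sequentially" for z
    using lim(2)
  proof
    assume "F = at_top"
    then show ?thesis using X by (simp add: filterlim_at_top le_diff_eq)
  next
    assume "F = at_bot"
    then show ?thesis using X by (simp add: filterlim_at_bot diff_le_eq)
  qed
  have "(\<lambda>n. h (g (X n - z))) \<longlonglongrightarrow> h a" for z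
    by (rule monostable_tendsto[OF h filterlim_compose[OF lim(1) 1] a]) (auto simp: unit_monoD[OF g])
  then have "(\<lambda>n. evolve h g (X n)) \<longlonglongrightarrow> (\<integral>z. h a \<partial>N)"
    by (intro evolve_tendsto h g) auto
  moreover have "(\<lambda>n. evolve h g (X n)) \<longlonglongrightarrow> a"
    unfolding fp by (rule filterlim_compose[OF lim(1) X])
  ultimately have "(\<integral>z. h a \<partial>N) = a" by (rule LIMSEQ_unique)
  then have "h a = a" using prob_space by simp
  then show ?thesis by (rule monostable_fixed_point[OF h _ a])
qed

lemma fixed_point_limits:
  assumes h: "monostable h" and g: "unit_mono g" and fp: "\<And>x. evolve h g x = g x"
    and x: "0 < g x1" "g x2 < 1"
  shows "(g \<longlongrightarrow> 0) at_bot \<and> (g \<longlongrightarrow> 1) at_top"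
proof
  obtain b where b: "(g \<longlongrightarrow> b) at_top" "g x1 \<le> b"
    using unit_mono_limits[OF g] by blast
  with fixed_point_limit[OF h g fp filterlim_real_sequentially b(1)] x show "(g \<longlongrightarrow> 1) at_top"
    by force
  obtain a where a: "(g \<longlongrightarrow> a) at_bot" "a \<le> g x2"
    using unit_mono_limits[OF g] by blast
  with fixed_point_limit[OF h g fp filterlim_compose[OF filterlim_uminus_at_bot_at_top filterlim_real_sequentially] a(1)] x
  show "(g \<longlongrightarrow> 0) at_bot"
    by force
qed

end

section \<open>Existence of a nontrivial fixed point\<close>

context jump_law begin

text \<open>
  The Laplace transform of \<open>N\<close> is continuous and decreases from 1 to 0, since \<open>N\<close> gives no mass to 0.
\<close>

lemma laplace_solvable:
  assumes "c > 1"
  shows "\<exists>r>0. c * (\<integral>z. exp (- (r * z)) \<partial>N) = 1"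
proof -
  define L where "L r = (\<integral>z. exp (- (r * z)) \<partial>N)" for r
  have lim: "(\<lambda>n. L (u n)) \<longlonglongrightarrow> (\<integral>z. f z \<partial>N)"
    if "\<And>n. 0 \<le> u n" "AE z in N. (\<lambda>n. exp (- (u n * z))) \<longlonglongrightarrow> f z" "f \<in> borel_measurable borel" for u f
    unfolding L_def
  proof (rule integral_dominated_convergence[where w="\<lambda>_. 1"])
    show "AE z in N. norm (exp (- (u n * z))) \<le> 1" for n
      using nonneg by eventually_elim (simp add: that)
  qed (use that in auto)
  have pos: "AE z in N. 0 < z"
  proof -
    have "{0} \<in> null_sets N"
      using atomless[of 0] by (auto simp: null_sets_def emeasure_eq_measure)
    then have "AE z in N. z \<noteq> 0" by (rule AE_I') auto
    with nonneg show ?thesis by eventually_elim auto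
  qed
  have "(\<lambda>n. L (real n)) \<longlonglongrightarrow> (\<integral>z. 0 \<partial>N)"
  proof (rule lim)
    show "AE z in N. (\<lambda>n. exp (- (real n * z))) \<longlonglongrightarrow> 0"
      using pos
    proof eventually_elim
      case (elim z)
      have "(\<lambda>n. exp (- z) ^ n) \<longlonglongrightarrow> 0" using elim by (intro LIMSEQ_realpow_zero) auto
      then show ?case by (simp add: exp_of_nat_mult[symmetric])
    qed
  qed auto
  then have "\<forall>\<^sub>F n in sequentially. L (real n) < 1 / c"
    using assms by (intro order_tendstoD(2)) auto
  then obtain n where n: "L (real n) < 1 / c" by (auto simp: eventually_sequentially)
  have "\<exists>r\<ge>0. r \<le> real n \<and> L r = 1 / c"
  proof (rule IVT2')
    show "1 / c \<le> L 0" using assms prob_space by (simp add: L_def)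
    show "continuous_on {0..real n} L"
    proof (rule continuous_on_sequentiallyI)
      fix u a assume "\<forall>n'. u n' \<in> {0..real n}" "u \<longlonglongrightarrow> a"
      then show "(\<lambda>n. L (u n)) \<longlonglongrightarrow> L a"
        unfolding L_def[of a] by (intro lim) (auto intro!: tendsto_intros)
    qed
  qed (use n in auto)
  then obtain r where r: "0 \<le> r" "L r = 1 / c" by blast
  moreover have "r \<noteq> 0" using r(2) assms prob_space by (auto simp: L_def)
  ultimately show ?thesis using assms by (intro exI[of _ r]) (auto simp: L_def)
qed

text \<open>
  Monotone iteration between the supersolution \<open>min 1 (exp (r x))\<close> and the subsolution
  \<open>min e (exp (r x))\<close>, where \<open>exp (r x)\<close> solves the linearised equation.
\<close>

lemma fixed_point_if_linear_near_0:
  assumes h: "monostable h" and "1 < c" and e: "0 < e" "e \<le> 1"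
    and above: "\<And>u. 0 \<le> u \<Longrightarrow> u \<le> 1 \<Longrightarrow> h u \<le> c * u"
    and linear: "\<And>u. 0 \<le> u \<Longrightarrow> u \<le> e \<Longrightarrow> h u = c * u"
  shows "\<exists>g. unit_mono g \<and> (\<forall>x. evolve h g x = g x) \<and> g 0 = 1 / 2"
proof -
  obtain r where r: "r > 0" "c * (\<integral>z. exp (- (r * z)) \<partial>N) = 1"
    using laplace_solvable[OF \<open>1 < c\<close>] by blast
  define up where "up x = min 1 (exp (r * x))" for x
  define lo where "lo x = min e (exp (r * x))" for x
  have um: "unit_mono up" "unit_mono lo"
    using r(1) e
    by (auto simp: unit_mono_def up_def lo_def min_le_iff_disj less_imp_le intro!: monoI min.mono)
  have exp_int: "integrable N (\<lambda>z. c * exp (r * (x - z)))" for x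
  proof (rule integrable_const_bound)
    show "AE z in N. norm (c * exp (r * (x - z))) \<le> c * exp (r * x)"
      using nonneg by eventually_elim (use r(1) \<open>1 < c\<close> in \<open>simp add: abs_mult\<close>)
  qed simp
  have exp_fix: "(\<integral>z. c * exp (r * (x - z)) \<partial>N) = exp (r * x)" for x
  proof -
    have "(\<integral>z. c * exp (r * (x - z)) \<partial>N) = (\<integral>z. exp (r * x) * (c * exp (- (r * z))) \<partial>N)"
      by (intro Bochner_Integration.integral_cong) (auto simp: algebra_simps exp_diff exp_minus field_simps)
    also have "\<dots> = exp (r * x)" using r(2) by simp
    finally show ?thesis .
  qed
  have up: "evolve h up x \<le> up x" for x
  proof -
    have "evolve h up x \<le> (\<integral>z. c * exp (r * (x - z)) \<partial>N)"
      unfolding evolve_def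
    proof (rule integral_mono[OF evolve_integrable[OF h um(1)] exp_int])
      fix z
      have "h (up (x - z)) \<le> c * up (x - z)"
        by (intro above unit_monoD[OF um(1)])
      also have "\<dots> \<le> c * exp (r * (x - z))" using \<open>1 < c\<close> by (simp add: up_def)
      finally show "h (up (x - z)) \<le> c * exp (r * (x - z))" .
    qed
    then show ?thesis using unit_monoD(3)[OF evolve_unit_mono[OF h um(1)], of x]
      unfolding exp_fix by (simp add: up_def)
  qed
  \<comment> \<open>Only values to the left of \<open>x\<close> enter, and there the subsolution is the exact exponential.\<close>
  have lo_left: "exp (r * x) \<le> evolve h lo x" if "exp (r * x) \<le> e" for x
  proof -
    have "(\<integral>z. c * exp (r * (x - z)) \<partial>N) \<le> evolve h lo x"
      unfolding evolve_def
    proof (rule integral_mono_AE[OF exp_int evolve_integrable[OF h um(2)]])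
      show "AE z in N. c * exp (r * (x - z)) \<le> h (lo (x - z))"
        using nonneg
      proof eventually_elim
        case (elim z)
        have "exp (r * (x - z)) \<le> exp (r * x)" using elim r(1) by simp
        then have "exp (r * (x - z)) \<le> e" using that by linarith
        then show ?case by (simp add: lo_def linear min_absorb2)
      qed
    qed
    then show ?thesis unfolding exp_fix .
  qed
  have lo: "lo x \<le> evolve h lo x" for x
  proof (cases "exp (r * x) \<le> e")
    case True
    then show ?thesis using lo_left by (simp add: lo_def)
  next
    case False
    \<comment> \<open>To the right of the corner \<open>y\<close> the subsolution is constant, and monotonicity in \<open>x\<close> suffices.\<close>
    define y where "y = ln e / r"
    have y: "exp (r * y) = e" using e r(1) by (simp add: y_def)
    with False have "exp (r * y) \<le> exp (r * x)" by simp
    then have "r * y \<le> r * x" by (simp only: exp_le_cancel_iff)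
    then have "y \<le> x" using r(1) by simp
    have "lo x \<le> exp (r * y)" by (simp add: lo_def y)
    also have "\<dots> \<le> evolve h lo y" using y by (intro lo_left) simp
    also have "\<dots> \<le> evolve h lo x"
      by (rule monoD[OF unit_monoD(1)[OF evolve_unit_mono[OF h um(2)]] \<open>y \<le> x\<close>])
    finally show ?thesis .
  qed
  define U where "U n = (evolve h ^^ n) up" for n
  have U_Suc: "U (Suc n) = evolve h (U n)" for n by (simp add: U_def)
  have U_um: "unit_mono (U n)" for n
    by (induction n) (simp_all add: U_def um evolve_unit_mono[OF h])
  have U_dec: "U (Suc n) x \<le> U n x" for n x
  proof (induction n arbitrary: x)
    case 0 then show ?case using up by (simp add: U_def)
  next
    case (Suc n)
    show ?case
      using evolve_le[OF h U_um U_um Suc.IH, of x] by (simp add: U_Suc)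
  qed
  have U_lo: "lo x \<le> U n x" for n x
  proof (induction n arbitrary: x)
    case 0 then show ?case using e by (simp add: U_def lo_def up_def min_le_iff_disj)
  next
    case (Suc n)
    have "lo x \<le> evolve h lo x" by (rule lo)
    also have "\<dots> \<le> evolve h (U n) x" by (rule evolve_le[OF h um(2) U_um Suc])
    finally show ?case by (simp add: U_Suc)
  qed
  have "convergent (\<lambda>n. U n x)" for x
  proof -
    have "decseq (\<lambda>n. U n x)" by (simp add: decseq_Suc_iff U_dec)
    then show ?thesis
      using decseq_convergent[of "\<lambda>n. U n x" 0] unit_monoD(2)[OF U_um] unfolding convergent_def by metis
  qed
  then obtain g where g: "\<And>x. (\<lambda>n. U n x) \<longlonglongrightarrow> g x"
    unfolding convergent_def by metis
  have g_um: "unit_mono g"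
    unfolding unit_mono_def
  proof (intro conjI allI monoI)
    fix x y :: real assume "x \<le> y"
    then show "g x \<le> g y"
      by (intro LIMSEQ_le[OF g g]) (auto intro: monoD[OF unit_monoD(1)[OF U_um]])
  next
    fix x show "g x \<in> {0..1}"
      using LIMSEQ_le_const[OF g, of 0 x] LIMSEQ_le_const2[OF g, of x 1] unit_monoD[OF U_um] by auto
  qed
  have g_fix: "evolve h g x = g x" for x
  proof -
    have "(\<lambda>n. evolve h (U n) x) \<longlonglongrightarrow> (\<integral>z. h (g (x - z)) \<partial>N)"
    proof (rule evolve_tendsto[OF h U_um])
      show "AE z in N. (\<lambda>n. h (U n (x - z))) \<longlonglongrightarrow> h (g (x - z))"
        by (intro AE_I2 monostable_tendsto[OF h g]) (auto simp: unit_monoD[OF g_um] unit_monoD[OF U_um])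
      show "(\<lambda>z. h (g (x - z))) \<in> borel_measurable borel"
        using evolve_integrable[OF h g_um, of x, THEN borel_measurable_integrable] by simp
    qed
    moreover have "(\<lambda>n. evolve h (U n) x) \<longlonglongrightarrow> g x"
      using LIMSEQ_Suc[OF g] by (simp add: U_Suc)
    ultimately show ?thesis using LIMSEQ_unique by (auto simp: evolve_def)
  qed
  have g_lo: "lo x \<le> g x" for x by (rule LIMSEQ_le_const[OF g]) (auto simp: U_lo)
  have g_up: "g x \<le> up x" for x
    using decseq_ge[OF _ g[of x], of 0] U_dec by (simp add: decseq_Suc_iff U_def)
  \<comment> \<open>At this point the supersolution keeps \<open>g\<close> away from 1, as the subsolution keeps it away from 0 at 0;
    together they force the limits of \<open>g\<close>.\<close>
  define x1 where "x1 = ln (1 / 2) / r"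
  have "up x1 \<le> 1 / 2" using r(1) by (simp add: up_def x1_def)
  then have x1: "g x1 \<le> 1 / 2" using g_up[of x1] by simp
  have "0 < g 0" using g_lo[of 0] e by (simp add: lo_def)
  moreover have "g x1 < 1" using x1 by simp
  ultimately have "(g \<longlongrightarrow> 1) at_top" using fixed_point_limits[OF h g_um g_fix, of 0 x1] by blast
  then have "\<forall>\<^sub>F x in at_top. 1 / 2 < g x" by (rule order_tendstoD(1)) simp
  then obtain x2 where x2: "1 / 2 < g x2" "x1 \<le> x2"
    unfolding eventually_at_top_linorder by (meson le_cases order.refl)
  have "evolve h g = g" using g_fix by auto
  then have "isCont g x" for x using evolve_isCont[OF h g_um, of x] by simp
  then have "\<exists>x\<ge>x1. x \<le> x2 \<and> g x = 1 / 2"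
    using x1 x2 by (intro IVT) auto
  then obtain a where a: "g a = 1 / 2" by blast
  show ?thesis
  proof (intro exI[of _ "\<lambda>x. g (x + a)"] conjI allI)
    show "evolve h (\<lambda>x. g (x + a)) x = g (x + a)" for x
      using g_fix[of "x + a"] by (simp add: evolve_def algebra_simps)
  qed (use a unit_mono_shift[OF g_um] in auto)
qed

text \<open>
  Replacing \<open>h\<close> by its chord on \<open>[0, e n]\<close> gives a nonlinearity that is linear near 0 and differs from
  \<open>h\<close> by at most \<open>h (e n)\<close>, uniformly. The value \<open>1 / 2\<close> at
  0 survives the limit because evolving makes convergence almost everywhere into convergence everywhere.
\<close>

lemma fixed_point_exists:
  assumes h: "monostable h" and star: "star_shaped h"
  shows "\<exists>g. unit_mono g \<and> (\<forall>x. evolve h g x = g x) \<and> g 0 = 1 / 2"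
proof -
  define e where "e n = 1 / (real n + 2)" for n
  have e: "0 < e n" "e n < 1" for n by (auto simp: e_def)
  have e0: "e \<longlonglongrightarrow> 0" unfolding e_def by real_asymp
  define c where "c n = h (e n) / e n" for n
  have c: "1 < c n" for n using h e[of n] by (auto simp: c_def monostable_def)
  define hs where "hs n u = min (c n * u) (h u)" for n u
  have hs_lin: "hs n u = c n * u" if "0 \<le> u" "u \<le> e n" for n u
  proof (cases "u = 0")
    case True then show ?thesis using h by (simp add: hs_def monostable_def)
  next
    case False
    then have "u * h (e n) \<le> e n * h u" using star that e[of n] by (auto simp: star_shaped_def)
    then have "c n * u \<le> h u" using e[of n] by (simp add: c_def field_simps)
    then show ?thesis by (simp add: hs_def)
  qed
  have hs_eq: "hs n u = h u" if "e n \<le> u" "u \<le> 1" for n u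
  proof -
    have "e n * h u \<le> u * h (e n)" using star that e[of n] by (auto simp: star_shaped_def)
    then have "h u \<le> c n * u" using e[of n] by (simp add: c_def field_simps)
    then show ?thesis by (simp add: hs_def)
  qed
  have hs_mono: "monostable (hs n)" for n
    unfolding monostable_def
  proof (intro conjI allI impI)
    show "mono_on {0..1} (hs n)"
      unfolding hs_def mono_on_def using c[of n]
      by (intro allI impI min.mono mult_left_mono) (auto intro!: monostable_mono[OF h])
    show "continuous_on {0..1} (hs n)"
      unfolding hs_def using h by (intro continuous_intros) (simp add: monostable_def)
    show "hs n 0 = 0" "hs n 1 = 1" using h c[of n] by (simp_all add: hs_def monostable_def)
    show "u < hs n u" if "0 < u \<and> u < 1" for u
      using that h c[of n] by (simp add: hs_def monostable_def)
  qed
  have "\<exists>g. unit_mono g \<and> (\<forall>x. evolve (hs n) g x = g x) \<and> g 0 = 1 / 2" for n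
    by (rule fixed_point_if_linear_near_0[OF hs_mono c e(1) less_imp_le[OF e(2)] _ hs_lin])
      (auto simp: hs_def)
  then obtain g where g: "\<And>n. unit_mono (g n)" "\<And>n x. evolve (hs n) (g n) x = g n x" "\<And>n. g n 0 = 1 / 2"
    by metis
  have g_cont: "isCont (g n) x" for n x
  proof -
    have "evolve (hs n) (g n) = g n" using g(2) by auto
    then show ?thesis using evolve_isCont[OF hs_mono[of n] g(1)[of n], of x] by simp
  qed
  obtain s F where s: "strict_mono (s :: nat \<Rightarrow> nat)" and F: "mono F"
    and lim: "\<And>x. isCont F x \<Longrightarrow> (\<lambda>n. g (s n) x) \<longlonglongrightarrow> F x"
    using Helly_selection[of g 1] g_cont unit_monoD(1)[OF g(1)] unit_mono_abs[OF g(1)]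
    by (metis continuous_at_imp_continuous_at_within)
  \<comment> \<open>Helly's theorem controls \<open>F\<close> only at its continuity points; clamping puts all values in \<open>[0, 1]\<close>.\<close>
  define G where "G x = max 0 (min 1 (F x))" for x
  have G_um: "unit_mono G"
    using F by (fastforce simp: unit_mono_def G_def mono_def)
  have G_lim: "(\<lambda>n. g (s n) x) \<longlonglongrightarrow> G x" if "isCont F x" for x
  proof -
    have "0 \<le> F x" "F x \<le> 1"
      using LIMSEQ_le_const[OF lim[OF that], of 0] LIMSEQ_le_const2[OF lim[OF that], of 1] unit_monoD[OF g(1)] by auto
    then show ?thesis using lim[OF that] by (simp add: G_def)
  qed
  have cont_ae: "AE z in N. isCont F (x - z)" for x
    by (rule AE_isCont_reflect) (auto simp: atomless mono_ctble_discont[OF F])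
  have hs_lim: "(\<lambda>n. hs (s n) (v n)) \<longlonglongrightarrow> h w"
    if "v \<longlonglongrightarrow> w" "0 \<le> w" "w \<le> 1" "\<And>n. 0 \<le> v n \<and> v n \<le> 1" for v w
  proof (rule Lim_transform2)
    show "(\<lambda>n. h (v n)) \<longlonglongrightarrow> h w" by (rule monostable_tendsto[OF h that])
    have "\<bar>h (v n) - hs (s n) (v n)\<bar> \<le> h (e (s n))" for n
    proof (cases "v n \<le> e (s n)")
      case True
      then have "hs (s n) (v n) = c (s n) * v n" using hs_lin that(4) by auto
      moreover have "hs (s n) (v n) \<le> h (v n)" by (simp add: hs_def)
      moreover have "0 \<le> hs (s n) (v n)" using monostable_range[OF hs_mono] that(4) by blast
      moreover have "h (v n) \<le> h (e (s n))"
        using True that(4) e[of "s n"] by (intro monostable_mono[OF h]) auto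
      ultimately show ?thesis by linarith
    next
      case False
      then show ?thesis using hs_eq[of "s n" "v n"] that(4)[of n] monostable_range[OF h, of "e (s n)"] e[of "s n"] by simp
    qed
    then have "\<forall>\<^sub>F n in sequentially. norm (h (v n) - hs (s n) (v n)) \<le> h (e (s n))" by simp
    moreover have "(\<lambda>n. h (e (s n))) \<longlonglongrightarrow> h 0"
      by (rule monostable_tendsto[OF h LIMSEQ_subseq_LIMSEQ[OF e0 s, unfolded comp_def]])
        (use e in \<open>auto intro: less_imp_le\<close>)
    moreover have "h 0 = 0" using h by (simp only: monostable_def)
    ultimately show "(\<lambda>n. h (v n) - hs (s n) (v n)) \<longlonglongrightarrow> 0"
      by (metis Lim_null_comparison)
  qed
  have conv: "(\<lambda>n. g (s n) x) \<longlonglongrightarrow> evolve h G x" for x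
  proof -
    have "(\<lambda>n. evolve (hs (s n)) (g (s n)) x) \<longlonglongrightarrow> (\<integral>z. h (G (x - z)) \<partial>N)"
    proof (rule evolve_tendsto[OF hs_mono g(1)])
      show "AE z in N. (\<lambda>n. hs (s n) (g (s n) (x - z))) \<longlonglongrightarrow> h (G (x - z))"
        using cont_ae[of x]
        by eventually_elim (auto intro!: hs_lim G_lim simp: unit_monoD[OF G_um] unit_monoD[OF g(1)])
      show "(\<lambda>z. h (G (x - z))) \<in> borel_measurable borel"
        using evolve_integrable[OF h G_um, of x, THEN borel_measurable_integrable] by simp
    qed
    then show ?thesis unfolding g(2) evolve_def[of h] .
  qed
  \<comment> \<open>The selected limit may differ from the pointwise limit \<open>p\<close> at the jumps of \<open>F\<close>, which \<open>N\<close> ignores.\<close>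
  define p where "p = evolve h G"
  have p_um: "unit_mono p" unfolding p_def by (rule evolve_unit_mono[OF h G_um])
  have "evolve h p x = p x" for x
  proof -
    have "AE z in N. G (x - z) = p (x - z)"
      using cont_ae[of x] by eventually_elim (auto intro: LIMSEQ_unique[OF G_lim conv] simp: p_def)
    moreover note [measurable] = evolve_integrable[OF h G_um, of x, THEN borel_measurable_integrable]
       evolve_integrable[OF h p_um, of x, THEN borel_measurable_integrable]
    ultimately have "(\<integral>z. h (G (x - z)) \<partial>N) = (\<integral>z. h (p (x - z)) \<partial>N)"
      by (intro integral_cong_AE) auto
    then show ?thesis by (simp add: p_def evolve_def)
  qed
  moreover have "p 0 = 1 / 2"
    using LIMSEQ_unique[OF conv[of 0], of "1 / 2"] unfolding g(3) p_def by simp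
  ultimately show ?thesis using p_um by blast
qed

end

section \<open>Tails of fixed points\<close>

text \<open>
  Write \<open>W (y - a)\<close> as the integral of its derivative over \<open>[0, y - a]\<close> and exchange the integrals.
\<close>

lemma layer_cake:
  fixes W w :: "real \<Rightarrow> real"
  assumes "finite_borel_measure M"
    and deriv: "\<And>x. 0 \<le> x \<Longrightarrow> (W has_real_derivative w x) (at x)"
    and w: "\<And>x. 0 \<le> x \<Longrightarrow> 0 \<le> w x" "w \<in> borel_measurable borel" and "W 0 = 0"
  shows "(\<integral>\<^sup>+x. ennreal (w x) * indicator {0..} x * emeasure M {a + x<..} \<partial>lborel)
    = (\<integral>\<^sup>+y. ennreal (W (y - a)) * indicator {a..} y \<partial>M)"
proof -
  interpret finite_borel_measure M by fact
  have [measurable_cong]: "sets M = sets borel" by (rule M_is_borel)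
  interpret pair_sigma_finite lborel M ..
  note w(2)[measurable]
  have "(\<integral>\<^sup>+x. ennreal (w x) * indicator {0..} x * emeasure M {a + x<..} \<partial>lborel)
    = (\<integral>\<^sup>+x. (\<integral>\<^sup>+y. ennreal (w x) * indicator {0..} x * indicator {a + x<..} y \<partial>M) \<partial>lborel)"
    by (simp add: nn_integral_cmult M_is_borel)
  also have "\<dots> = (\<integral>\<^sup>+x. (\<integral>\<^sup>+y. ennreal (w x) * indicator {0..} x * (if a + x < y then 1 else 0) \<partial>M) \<partial>lborel)"
    by (intro nn_integral_cong) (auto split: split_indicator)
  also have "\<dots> = (\<integral>\<^sup>+y. (\<integral>\<^sup>+x. ennreal (w x) * indicator {0..} x * (if a + x < y then 1 else 0) \<partial>lborel) \<partial>M)"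
    by (rule Fubini'[symmetric]) measurable
  also have "\<dots> = (\<integral>\<^sup>+y. ennreal (W (y - a)) * indicator {a..} y \<partial>M)"
  proof (rule nn_integral_cong)
    fix y
    show "(\<integral>\<^sup>+x. ennreal (w x) * indicator {0..} x * (if a + x < y then 1 else 0) \<partial>lborel)
      = ennreal (W (y - a)) * indicator {a..} y"
    proof (cases "a \<le> y")
      case True
      have "(\<integral>\<^sup>+x. ennreal (w x) * indicator {0..} x * (if a + x < y then 1 else 0) \<partial>lborel) =
        (\<integral>\<^sup>+x. ennreal (w x) * indicator {0..y - a} x \<partial>lborel)"
        by (rule nn_integral_cong_AE)
          (use AE_lborel_singleton[of "y - a"] in eventually_elim, auto simp: indicator_def)
      also have "\<dots> = ennreal (W (y - a) - W 0)"
      proof (rule nn_integral_FTC_Icc)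
        show "(W has_real_derivative w x) (at x)" if "x \<in> {0..y - a}" for x
          using deriv that by simp
      qed (use True w in auto)
      finally show ?thesis using True assms(5) by simp
    next
      case False
      then show ?thesis by (auto simp: indicator_def intro!: nn_integral_zero')
    qed
  qed
  finally show ?thesis .
qed

lemma power_div_fact_le_exp:
  assumes "0 \<le> (t :: real)"
  shows "t ^ n / fact n \<le> exp t"
proof -
  have "(\<Sum>k\<in>{n}. t ^ k /\<^sub>R fact k) \<le> (\<Sum>k. t ^ k /\<^sub>R fact k)"
    using assms by (intro sum_le_suminf sums_summable[OF exp_converges]) auto
  also have "\<dots> = exp t" using exp_converges[of t] by (simp add: sums_iff)
  finally show ?thesis by (simp add: field_simps)
qed

context jump_law begin

text \<open>
  Near the unstable state \<open>h u \<ge> k u\<close> with \<open>k > 1\<close>. Displacements of size at most \<open>a\<close> have a probability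
  so close to 1 that \<open>g x \<ge> k N {..a} g (x - a)\<close> still gains a factor above 1.
\<close>

lemma left_tail_geometric:
  assumes h: "monostable h" and star: "star_shaped h"
    and g: "unit_mono g" and fp: "\<And>x. evolve h g x = g x" and lim: "(g \<longlongrightarrow> 0) at_bot"
  shows "\<exists>a>0. \<exists>\<rho>>1. \<exists>x0. \<forall>j. g (x0 - real j * a) \<le> (1 / \<rho>) ^ j"
proof -
  \<comment> \<open>The slope of the chord of \<open>h\<close> over \<open>[0, 1 / 2]\<close>.\<close>
  define k where "k = 2 * h (1 / 2)"
  have k: "1 < k" using monostable_gt[OF h, of "1 / 2"] by (simp add: k_def)
  have hk: "k * u \<le> h u" if "0 \<le> u" "u \<le> 1 / 2" for u
  proof (cases "u = 0")
    case True then show ?thesis using monostable_0[OF h] by simp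
  next
    case False
    then have "u * h (1 / 2) \<le> 1 / 2 * h u" using star_shapedD[OF star, of u "1 / 2"] that by simp
    then show ?thesis by (simp add: k_def ac_simps)
  qed
  have "\<forall>\<^sub>F x in at_top. 1 / k < cdf N x"
    using k by (intro order_tendstoD(1)[OF cdf_lim_at_top_prob]) simp
  then obtain a0 where a0: "\<And>x. a0 \<le> x \<Longrightarrow> 1 / k < cdf N x" by (auto simp: eventually_at_top_linorder)
  define a where "a = max a0 1"
  define \<rho> where "\<rho> = k * measure N {..a}"
  have a: "a > 0" by (simp add: a_def)
  have "1 / k < measure N {..a}" using a0[of a] by (simp add: a_def cdf_def)
  then have \<rho>: "1 < \<rho>" using k by (simp add: \<rho>_def field_simps)
  have "\<forall>\<^sub>F x in at_bot. g x < 1 / 2" using lim by (rule order_tendstoD(2)) simp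
  then obtain x0 where x0: "g x0 < 1 / 2" by (auto simp: eventually_at_bot_linorder)
  have step: "\<rho> * g (x - a) \<le> g x" if "x \<le> x0" for x
  proof -
    have "\<rho> * g (x - a) = (\<integral>z. k * g (x - a) * indicator {..a} z \<partial>N)"
      by (simp add: \<rho>_def)
    also have "\<dots> \<le> (\<integral>z. h (g (x - z)) \<partial>N)"
    proof (rule integral_mono_AE[OF _ evolve_integrable[OF h g]])
      show "AE z in N. k * g (x - a) * indicator {..a} z \<le> h (g (x - z))"
        using nonneg
      proof eventually_elim
        case (elim z)
        have "g (x - z) \<le> g x0" using elim that by (intro monoD[OF unit_monoD(1)[OF g]]) simp
        then have "k * g (x - z) \<le> h (g (x - z))" using x0 by (intro hk unit_monoD(2)[OF g]) simp
        moreover have "k * g (x - a) \<le> k * g (x - z)" if "z \<le> a"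
          using that k by (intro mult_left_mono monoD[OF unit_monoD(1)[OF g]]) auto
        moreover have "0 \<le> h (g (x - z))" using unit_monoD(2)[OF unit_mono_comp[OF h g]] .
        ultimately show ?case by (auto simp: indicator_def)
      qed
    qed (intro integrable_mult_right, simp add: integrable_indicator_iff emeasure_eq_measure)
    also have "\<dots> = g x" using fp[of x] by (simp only: evolve_def)
    finally show ?thesis .
  qed
  have "g (x0 - real j * a) \<le> (1 / \<rho>) ^ j" for j
  proof (induction j)
    case 0 then show ?case using unit_monoD(3)[OF g] by simp
  next
    case (Suc j)
    have "\<rho> * g (x0 - real j * a - a) \<le> g (x0 - real j * a)" using a by (intro step) simp
    also note Suc
    finally have "g (x0 - real j * a - a) \<le> (1 / \<rho>) ^ j / \<rho>"
      using \<rho> by (simp add: field_simps)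
    moreover have shift: "x0 - real (Suc j) * a = x0 - real j * a - a" by (simp add: algebra_simps)
    ultimately show ?case unfolding shift by simp
  qed
  then show ?thesis using a \<rho> by blast
qed

end

text \<open>
  Powers are dominated by an exponential whose rate is half of the rate of decay; the contributions of
  the intervals of length \<open>a\<close> then form a geometric series.
\<close>

lemma left_moment:
  assumes M: "real_distribution M" and "\<And>x. cdf M x = g x"
    and "a > 0" "\<rho> > 1" and geo: "\<And>j. g (x0 - real j * a) \<le> (1 / \<rho>) ^ j"
  shows "(\<integral>\<^sup>+y. ennreal (\<bar>y\<bar> ^ n) * indicator {..x0} y \<partial>M) < \<infinity>"
proof -
  interpret M: real_distribution M by fact
  define d where "d = ln \<rho> / (2 * a)"
  have d: "d > 0" using assms by (simp add: d_def)
  have "exp (d * a) = exp (ln \<rho> / 2)" using assms by (simp add: d_def)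
  also have "\<dots> = sqrt \<rho>" using assms by (simp add: ln_sqrt[symmetric])
  finally have da: "exp (d * a) = sqrt \<rho>" .
  define K where "K = fact n / d ^ n * exp (d * (\<bar>x0\<bar> + a))"
  have K: "0 \<le> K" using d by (simp add: K_def)
  have bound: "\<bar>y\<bar> ^ n \<le> K * sqrt \<rho> ^ j" if "y \<le> x0" "x0 - real (Suc j) * a \<le> y" for y j
  proof -
    have "(d * \<bar>y\<bar>) ^ n / fact n \<le> exp (d * \<bar>y\<bar>)"
      using d by (intro power_div_fact_le_exp) simp
    also have "d * \<bar>y\<bar> \<le> d * (\<bar>x0\<bar> + a + real j * a)"
      using that assms(3) d by (intro mult_left_mono) (auto simp: abs_le_iff algebra_simps)
    then have "exp (d * \<bar>y\<bar>) \<le> exp (d * (\<bar>x0\<bar> + a) + real j * (d * a))"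
      by (simp add: algebra_simps)
    also have "\<dots> = exp (d * (\<bar>x0\<bar> + a)) * sqrt \<rho> ^ j"
      by (simp only: exp_add exp_of_nat_mult da)
    finally show ?thesis using d by (simp add: K_def power_mult_distrib field_simps)
  qed
  define f where "f j y = ennreal (K * sqrt \<rho> ^ j) * indicator {..x0 - real j * a} y" for j y
  have "ennreal (\<bar>y\<bar> ^ n) * indicator {..x0} y \<le> (\<Sum>j. f j y)" for y
  proof (cases "y \<le> x0")
    case True
    define j where "j = nat \<lfloor>(x0 - y) / a\<rfloor>"
    have "0 \<le> (x0 - y) / a" using True assms(3) by simp
    then have "real j \<le> (x0 - y) / a" "(x0 - y) / a < real j + 1"
      by (auto simp: j_def)
    then have j: "y \<le> x0 - real j * a" "x0 - real (Suc j) * a \<le> y"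
      using assms(3) by (simp_all add: field_simps)
    have "ennreal (\<bar>y\<bar> ^ n) \<le> f j y"
      using bound[OF True j(2)] j(1) by (simp add: f_def ennreal_leI)
    also have "\<dots> \<le> (\<Sum>j. f j y)"
      using sum_le_suminf[of "\<lambda>j. f j y" "{j}"] by (simp add: summableI)
    finally show ?thesis using True by simp
  qed simp
  then have "(\<integral>\<^sup>+y. ennreal (\<bar>y\<bar> ^ n) * indicator {..x0} y \<partial>M) \<le> (\<integral>\<^sup>+y. (\<Sum>j. f j y) \<partial>M)"
    by (rule nn_integral_mono)
  also have "\<dots> = (\<Sum>j. \<integral>\<^sup>+y. f j y \<partial>M)"
    by (rule nn_integral_suminf) (simp add: f_def)
  also have "\<dots> \<le> (\<Sum>j. ennreal (K * (1 / sqrt \<rho>) ^ j))"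
  proof (rule suminf_le)
    fix j
    have "(\<integral>\<^sup>+y. f j y \<partial>M) = ennreal (K * sqrt \<rho> ^ j) * ennreal (g (x0 - real j * a))"
      using assms(2)[of "x0 - real j * a"]
      by (simp add: f_def nn_integral_cmult M.emeasure_eq_measure cdf_def)
    also have "\<dots> \<le> ennreal (K * sqrt \<rho> ^ j) * ennreal ((1 / \<rho>) ^ j)"
      by (intro mult_left_mono ennreal_leI geo) simp
    also have "\<dots> = ennreal (K * (sqrt \<rho> * (1 / \<rho>)) ^ j)"
      using K assms by (simp add: ennreal_mult[symmetric] power_mult_distrib power_divide)
    also have "sqrt \<rho> * (1 / \<rho>) = 1 / sqrt \<rho>"
      using assms by (simp add: field_simps)
    finally show "(\<integral>\<^sup>+y. f j y \<partial>M) \<le> ennreal (K * (1 / sqrt \<rho>) ^ j)" .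
  qed (auto intro: summableI)
  also have "\<dots> < \<infinity>"
  proof -
    have "summable (\<lambda>j. K * (1 / sqrt \<rho>) ^ j)"
      using assms by (intro summable_mult summable_geometric) simp
    then show ?thesis using K assms by (subst suminf_ennreal2) auto
  qed
  finally show ?thesis .
qed

context jump_law begin

text \<open>
  Let \<open>q x = 1 - g (x0 + x)\<close>. By flatness of \<open>h\<close> at 1, \<open>q\<close> is bounded by \<open>\<epsilon>\<close> times its convolution with
  \<open>N\<close> plus the tail of \<open>N\<close>. The weight \<open>w x = (1 + x) ^ m\<close> is submultiplicative, so the convolution costs
  at most the factor \<open>\<epsilon> \<integral> w dN \<le> 1 / 2\<close> and can be absorbed into the left-hand side.
\<close>

lemma right_tail:
  assumes h: "monostable h"
    and flat: "\<And>\<epsilon>. 0 < \<epsilon> \<Longrightarrow> \<exists>\<delta>>0. \<forall>v. 0 \<le> v \<and> 1 - \<delta> \<le> v \<and> v \<le> 1 \<longrightarrow> 1 - h v \<le> \<epsilon> * (1 - v)"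
    and g: "unit_mono g" and fp: "\<And>x. evolve h g x = g x" and lim: "(g \<longlongrightarrow> 1) at_top"
    and mom: "(\<integral>\<^sup>+z. ennreal ((1 + z) ^ Suc m) * indicator {0..} z \<partial>N) < \<infinity>"
  shows "\<exists>x0. (\<integral>\<^sup>+x. ennreal ((1 + x) ^ m) * indicator {0..} x * ennreal (1 - g (x0 + x)) \<partial>lborel) < \<infinity>"
proof -
  define w where "w x = (1 + x) ^ m" for x :: real
  have w0: "0 \<le> w x" if "0 \<le> x" for x using that by (simp add: w_def)
  have [measurable]: "w \<in> borel_measurable borel" unfolding w_def by measurable
  note [measurable] = unit_mono_measurable[OF g]
  interpret pair_sigma_finite lborel N ..
  define B where "B = (\<integral>\<^sup>+z. ennreal (w z) * indicator {0..} z \<partial>N)"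
  have "B \<le> (\<integral>\<^sup>+z. ennreal ((1 + z) ^ Suc m) * indicator {0..} z \<partial>N)"
    unfolding B_def
  proof (rule nn_integral_mono)
    fix z :: real
    have "(1 + z) ^ m \<le> (1 + z) ^ Suc m" if "0 \<le> z" using that by (intro power_increasing) auto
    then show "ennreal (w z) * indicator {0..} z \<le> ennreal ((1 + z) ^ Suc m) * indicator {0..} z"
      by (cases "0 \<le> z") (simp_all add: w_def ennreal_leI del: power_Suc)
  qed
  also note mom
  finally have "B < \<infinity>" .
  then obtain b where b: "B = ennreal b" "0 \<le> b" by (cases B) auto
  \<comment> \<open>Small enough for the absorption at the end; the summand 1 makes the positivity of \<open>\<epsilon>\<close> immediate.\<close>
  define \<epsilon> where "\<epsilon> = 1 / (2 * (b + 1))"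
  have eps: "0 < \<epsilon>" "\<epsilon> * b \<le> 1 / 2" using b(2) by (auto simp: \<epsilon>_def field_simps)
  obtain \<delta> where \<delta>: "0 < \<delta>" "\<And>v. 0 \<le> v \<Longrightarrow> 1 - \<delta> \<le> v \<Longrightarrow> v \<le> 1 \<Longrightarrow> 1 - h v \<le> \<epsilon> * (1 - v)"
    using flat[OF eps(1)] by blast
  have "\<forall>\<^sub>F x in at_top. 1 - \<delta> < g x" using lim \<delta>(1) by (intro order_tendstoD(1)) auto
  then obtain x0 where x0: "1 - \<delta> < g x0" by (auto simp: eventually_at_top_linorder)
  define q where "q x = 1 - g (x0 + x)" for x
  have [measurable]: "q \<in> borel_measurable borel" unfolding q_def by measurable
  have q: "0 \<le> q x" "q x \<le> 1" for x using unit_monoD[OF g] by (auto simp: q_def)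
  define k where "k x z = ennreal \<epsilon> * ennreal (q (x - z)) * indicator {0..} z * indicator {0..} (x - z)" for x z
  have [measurable]: "(\<lambda>(x, z). k x z) \<in> borel_measurable (borel \<Otimes>\<^sub>M borel)"
    unfolding k_def by measurable
  have renewal: "ennreal (q x) \<le> (\<integral>\<^sup>+z. k x z \<partial>N) + emeasure N {x<..}" if "0 \<le> x" for x
  proof -
    note um = unit_mono_comp[OF h g]
    have int: "integrable N (\<lambda>z. 1 - h (g (x0 + x - z)))"
      by (intro Bochner_Integration.integrable_diff evolve_integrable[OF h g]) simp
    have "(\<integral>z. 1 - h (g (x0 + x - z)) \<partial>N) = 1 - evolve h g (x0 + x)"
      unfolding evolve_def using prob_space
      by (subst Bochner_Integration.integral_diff[OF _ evolve_integrable[OF h g]]) simp_all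
    then have "ennreal (q x) = ennreal (\<integral>z. 1 - h (g (x0 + x - z)) \<partial>N)"
      by (simp only: fp q_def)
    also have "\<dots> = (\<integral>\<^sup>+z. ennreal (1 - h (g (x0 + x - z))) \<partial>N)"
      by (rule nn_integral_eq_integral[symmetric, OF int]) (simp add: unit_monoD(3)[OF um])
    also have "\<dots> \<le> (\<integral>\<^sup>+z. k x z + indicator {x<..} z \<partial>N)"
    proof (rule nn_integral_mono_AE)
      show "AE z in N. ennreal (1 - h (g (x0 + x - z))) \<le> k x z + indicator {x<..} z"
        using nonneg
      proof eventually_elim
        case (elim z)
        show ?case
        proof (cases "z \<le> x")
          case True
          have "g x0 \<le> g (x0 + x - z)" using True by (intro monoD[OF unit_monoD(1)[OF g]]) simp
          then have "1 - h (g (x0 + x - z)) \<le> \<epsilon> * (1 - g (x0 + x - z))"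
            using x0 by (intro \<delta>(2) unit_monoD(2,3)[OF g]) simp
          also have "\<dots> = \<epsilon> * q (x - z)" by (simp add: q_def algebra_simps)
          finally have "ennreal (1 - h (g (x0 + x - z))) \<le> ennreal (\<epsilon> * q (x - z))"
            by (rule ennreal_leI)
          also have "\<dots> = ennreal \<epsilon> * ennreal (q (x - z))"
            using eps q by (intro ennreal_mult) auto
          finally show ?thesis using True elim by (simp add: k_def)
        next
          case False
          have "1 - h (g (x0 + x - z)) \<le> 1" using unit_monoD(2)[OF um, of "x0 + x - z"] by simp
          then have "ennreal (1 - h (g (x0 + x - z))) \<le> ennreal 1" by (rule ennreal_leI)
          then show ?thesis using False by (simp add: k_def)
        qed
      qed
    qed
    also have "\<dots> = (\<integral>\<^sup>+z. k x z \<partial>N) + emeasure N {x<..}"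
      by (subst nn_integral_add) auto
    finally show ?thesis .
  qed
  \<comment> \<open>Absorption needs a finite quantity, so the weighted integral is truncated at \<open>A\<close>.\<close>
  define T where "T A = (\<integral>\<^sup>+x. ennreal (w x) * indicator {0..A} x * ennreal (q x) \<partial>lborel)" for A
  define B2 where "B2 = (\<integral>\<^sup>+x. ennreal (w x) * indicator {0..} x * emeasure N {0 + x<..} \<partial>lborel)"
  have "B2 = (\<integral>\<^sup>+y. ennreal (((1 + (y - 0)) ^ Suc m - 1) / Suc m) * indicator {0..} y \<partial>N)"
    unfolding B2_def
  proof (rule layer_cake[OF finite_borel_measure_M])
    show "((\<lambda>x. ((1 + x) ^ Suc m - 1) / Suc m) has_real_derivative w x) (at x)" for x
      unfolding w_def by (auto intro!: derivative_eq_intros simp del: power_Suc)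
  qed (use w0 in auto)
  also have "\<dots> \<le> (\<integral>\<^sup>+z. ennreal ((1 + z) ^ Suc m) * indicator {0..} z \<partial>N)"
  proof (rule nn_integral_mono)
    fix y :: real
    have "((1 + y) ^ Suc m - 1) / Suc m \<le> (1 + y) ^ Suc m" if "0 \<le> y"
    proof -
      have "1 \<le> (1 + y) ^ Suc m" using that by (intro one_le_power) simp
      then have "(1 + y) ^ Suc m * 1 \<le> (1 + y) ^ Suc m * real (Suc m)" by (intro mult_left_mono) auto
      then have "(1 + y) ^ Suc m - 1 \<le> (1 + y) ^ Suc m * real (Suc m)" by linarith
      then show ?thesis by (subst pos_divide_le_eq) auto
    qed
    then show "ennreal (((1 + (y - 0)) ^ Suc m - 1) / Suc m) * indicator {0..} y \<le> ennreal ((1 + y) ^ Suc m) * indicator {0..} y"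
      by (cases "0 \<le> y") (simp_all add: ennreal_leI del: power_Suc of_nat_Suc)
  qed
  also note mom
  finally have "B2 < \<infinity>" .
  then obtain b2 where b2: "B2 = ennreal b2" "0 \<le> b2" by (cases B2) auto
  have T_le: "T A \<le> ennreal (2 * b2)" for A
  proof -
    define v where "v x = ennreal (w x) * indicator {0..A} x" for x
    have [measurable]: "v \<in> borel_measurable borel" unfolding v_def by measurable
    have "T A \<le> (\<integral>\<^sup>+x. ennreal ((1 + \<bar>A\<bar>) ^ m) * indicator {0..A} x \<partial>lborel)"
      unfolding T_def
    proof (rule nn_integral_mono)
      fix x
      show "ennreal (w x) * indicator {0..A} x * ennreal (q x) \<le> ennreal ((1 + \<bar>A\<bar>) ^ m) * indicator {0..A} x"
      proof (cases "x \<in> {0..A}")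
        case True
        then have "w x * q x \<le> (1 + \<bar>A\<bar>) ^ m * 1"
          unfolding w_def using q by (intro mult_mono power_mono) auto
        then have "ennreal (w x * q x) \<le> ennreal ((1 + \<bar>A\<bar>) ^ m)" by (intro ennreal_leI) simp
        moreover have "ennreal (w x * q x) = ennreal (w x) * ennreal (q x)"
          using True by (intro ennreal_mult w0 q) auto
        ultimately show ?thesis using True by simp
      qed simp
    qed
    also have "\<dots> < \<infinity>" by (simp add: nn_integral_cmult ennreal_mult_less_top emeasure_lborel_Icc_eq)
    finally have "T A < \<infinity>" .
    then obtain t where t: "T A = ennreal t" "0 \<le> t" by (cases "T A") auto
    have "T A \<le> (\<integral>\<^sup>+x. v x * (\<integral>\<^sup>+z. k x z \<partial>N) + ennreal (w x) * indicator {0..} x * emeasure N {0 + x<..} \<partial>lborel)"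
      unfolding T_def
    proof (rule nn_integral_mono)
      fix x :: real
      show "ennreal (w x) * indicator {0..A} x * ennreal (q x) \<le>
        v x * (\<integral>\<^sup>+z. k x z \<partial>N) + ennreal (w x) * indicator {0..} x * emeasure N {0 + x<..}"
      proof (cases "x \<in> {0..A}")
        case True
        then have "ennreal (w x) * ennreal (q x) \<le> ennreal (w x) * ((\<integral>\<^sup>+z. k x z \<partial>N) + emeasure N {x<..})"
          by (intro mult_left_mono renewal) auto
        then show ?thesis using True by (simp add: v_def distrib_left)
      qed simp
    qed
    also have "\<dots> = (\<integral>\<^sup>+x. v x * (\<integral>\<^sup>+z. k x z \<partial>N) \<partial>lborel) + B2"
      unfolding B2_def
    proof (rule nn_integral_add)
      have "(\<lambda>x. \<integral>\<^sup>+z. indicator {0<..} (z - x) \<partial>N) \<in> borel_measurable borel" by measurable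
      also have "(\<lambda>x. \<integral>\<^sup>+z. indicator {0<..} (z - x) \<partial>N) = (\<lambda>x. emeasure N {0 + x<..})"
      proof
        fix x :: real
        have "(\<integral>\<^sup>+z. indicator {0<..} (z - x) \<partial>N) = (\<integral>\<^sup>+z. indicator {0 + x<..} z \<partial>N)"
          by (intro nn_integral_cong) (simp split: split_indicator)
        then show "(\<integral>\<^sup>+z. indicator {0<..} (z - x) \<partial>N) = emeasure N {0 + x<..}" by simp
      qed
      finally have [measurable]: "(\<lambda>x. emeasure N {0 + x<..}) \<in> borel_measurable borel" .
      show "(\<lambda>x. ennreal (w x) * indicator {0..} x * emeasure N {0 + x<..}) \<in> borel_measurable lborel"
        by measurable
    qed measurable
    also have "(\<integral>\<^sup>+x. v x * (\<integral>\<^sup>+z. k x z \<partial>N) \<partial>lborel) = (\<integral>\<^sup>+x. (\<integral>\<^sup>+z. v x * k x z \<partial>N) \<partial>lborel)"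
      by (intro nn_integral_cong nn_integral_cmult[symmetric]) measurable
    also have "\<dots> = (\<integral>\<^sup>+z. (\<integral>\<^sup>+x. v x * k x z \<partial>lborel) \<partial>N)"
      by (rule Fubini'[symmetric]) measurable
    also have "\<dots> \<le> (\<integral>\<^sup>+z. ennreal \<epsilon> * T A * (ennreal (w z) * indicator {0..} z) \<partial>N)"
    proof (rule nn_integral_mono)
      fix z
      have "(\<integral>\<^sup>+x. v x * k x z \<partial>lborel) = (\<integral>\<^sup>+y. v (z + y) * k (z + y) z \<partial>lborel)"
        by (subst nn_integral_real_affine[where c=1 and t=z]) simp_all
      also have "\<dots> \<le> (\<integral>\<^sup>+y. ennreal \<epsilon> * (ennreal (w z) * indicator {0..} z) * (ennreal (w y) * indicator {0..A} y * ennreal (q y)) \<partial>lborel)"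
      proof (rule nn_integral_mono)
        fix y
        show "v (z + y) * k (z + y) z
          \<le> ennreal \<epsilon> * (ennreal (w z) * indicator {0..} z) * (ennreal (w y) * indicator {0..A} y * ennreal (q y))"
        proof (cases "0 \<le> z \<and> 0 \<le> y \<and> z + y \<le> A")
          case True
          have "0 \<le> z * y" using True by simp
          then have "w (z + y) \<le> w z * w y"
            unfolding w_def power_mult_distrib[symmetric] using True by (intro power_mono) (auto simp: algebra_simps)
          then have "ennreal (w (z + y)) \<le> ennreal (w z) * ennreal (w y)"
            using True w0 by (simp add: ennreal_mult[symmetric] ennreal_leI)
          then have "ennreal (w (z + y)) * (ennreal \<epsilon> * ennreal (q y)) \<le> ennreal (w z) * ennreal (w y) * (ennreal \<epsilon> * ennreal (q y))"
            by (rule mult_right_mono) simp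
          then show ?thesis using True by (simp add: v_def k_def ac_simps)
        next
          case False
          then have "v (z + y) * k (z + y) z = 0" by (auto simp: v_def k_def indicator_def)
          then show ?thesis by (simp only: zero_le)
        qed
      qed
      also have "\<dots> = ennreal \<epsilon> * (ennreal (w z) * indicator {0..} z) * T A"
        unfolding T_def by (rule nn_integral_cmult) measurable
      finally show "(\<integral>\<^sup>+x. v x * k x z \<partial>lborel) \<le> ennreal \<epsilon> * T A * (ennreal (w z) * indicator {0..} z)"
        by (simp only: ac_simps)
    qed
    also have "\<dots> = ennreal \<epsilon> * T A * B"
      unfolding B_def by (rule nn_integral_cmult) measurable
    finally have "ennreal t \<le> ennreal \<epsilon> * ennreal t * ennreal b + ennreal b2"
      unfolding t(1) b(1) b2(1) by (simp add: add_right_mono)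
    also have "\<dots> = ennreal (\<epsilon> * t * b + b2)"
      using eps t b b2 by (simp add: ennreal_mult)
    finally have "t \<le> \<epsilon> * t * b + b2"
      using eps t(2) b(2) b2(2) by (subst (asm) ennreal_le_iff) auto
    moreover have "\<epsilon> * t * b \<le> 1 / 2 * t"
      using mult_right_mono[OF eps(2) t(2)] by (simp add: ac_simps)
    ultimately have "t \<le> 2 * b2" by simp
    then show ?thesis using t by (simp add: ennreal_leI)
  qed
  have "(\<integral>\<^sup>+x. ennreal (w x) * indicator {0..} x * ennreal (q x) \<partial>lborel)
    \<le> (\<integral>\<^sup>+x. (SUP i. ennreal (w x) * indicator {0..real i} x * ennreal (q x)) \<partial>lborel)"
  proof (rule nn_integral_mono)
    fix x
    obtain i where "x \<le> real i" using real_arch_simple by blast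
    then have "ennreal (w x) * indicator {0..} x * ennreal (q x) = ennreal (w x) * indicator {0..real i} x * ennreal (q x)"
      by (simp split: split_indicator)
    also have "\<dots> \<le> (SUP i. ennreal (w x) * indicator {0..real i} x * ennreal (q x))"
      by (rule SUP_upper) simp
    finally show "ennreal (w x) * indicator {0..} x * ennreal (q x) \<le> (SUP i. ennreal (w x) * indicator {0..real i} x * ennreal (q x))" .
  qed
  also have "\<dots> = (SUP i. T (real i))"
    unfolding T_def
  proof (rule nn_integral_monotone_convergence_SUP)
    show "incseq (\<lambda>i x. ennreal (w x) * indicator {0..real i} x * ennreal (q x))"
      unfolding incseq_def le_fun_def
      by (intro allI impI mult_right_mono mult_left_mono) (auto split: split_indicator)
  qed measurable
  also have "\<dots> \<le> ennreal (2 * b2)" by (rule SUP_least) (rule T_le)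
  also have "\<dots> < \<infinity>" by simp
  finally show ?thesis unfolding w_def q_def by blast
qed

end

text \<open>
  The layer-cake formula, started at \<open>x0\<close>, turns the weighted tail into a moment.
\<close>

lemma right_moment:
  assumes M: "real_distribution M" and cdf: "\<And>x. cdf M x = g x"
    and tail: "(\<integral>\<^sup>+x. ennreal ((1 + x) ^ m) * indicator {0..} x * ennreal (1 - g (x0 + x)) \<partial>lborel) < \<infinity>"
  shows "(\<integral>\<^sup>+y. ennreal (\<bar>y\<bar> ^ Suc m) * indicator {x0..} y \<partial>M) < \<infinity>"
proof -
  interpret M: real_distribution M by fact
  define W where "W x = ((1 + x) ^ Suc m - 1) / Suc m" for x :: real
  have compl: "M.prob {a<..} = 1 - g a" for a
    using M.prob_compl[of "{..a}"] cdf[of a] by (simp add: cdf_def Compl_eq_Diff_UNIV[symmetric])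
  have "(\<integral>\<^sup>+x. ennreal ((1 + x) ^ m) * indicator {0..} x * emeasure M {x0 + x<..} \<partial>lborel) < \<infinity>"
    using tail by (simp only: M.emeasure_eq_measure compl)
  also have "(\<integral>\<^sup>+x. ennreal ((1 + x) ^ m) * indicator {0..} x * emeasure M {x0 + x<..} \<partial>lborel)
     = (\<integral>\<^sup>+y. ennreal (W (y - x0)) * indicator {x0..} y \<partial>M)"
  proof (rule layer_cake[OF M.finite_borel_measure_M])
    show "(W has_real_derivative (1 + x) ^ m) (at x)" for x
      unfolding W_def by (auto intro!: derivative_eq_intros simp del: power_Suc)
  qed (auto simp: W_def)
  finally have fin: "(\<integral>\<^sup>+y. ennreal (W (y - x0)) * indicator {x0..} y \<partial>M) < \<infinity>" .
  define K where "K = (1 + \<bar>x0\<bar>) ^ Suc m"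
  have K: "0 \<le> K" by (simp add: K_def)
  have [measurable]: "W \<in> borel_measurable borel" unfolding W_def by measurable
  have "(\<integral>\<^sup>+y. ennreal (\<bar>y\<bar> ^ Suc m) * indicator {x0..} y \<partial>M) \<le>
     (\<integral>\<^sup>+y. ennreal (K * Suc m) * (ennreal (W (y - x0)) * indicator {x0..} y) + ennreal K \<partial>M)"
  proof (rule nn_integral_mono)
    fix y
    show "ennreal (\<bar>y\<bar> ^ Suc m) * indicator {x0..} y \<le> ennreal (K * Suc m) * (ennreal (W (y - x0)) * indicator {x0..} y) + ennreal K"
    proof (cases "x0 \<le> y")
      case True
      have "0 \<le> \<bar>x0\<bar> * (y - x0)" using True by simp
      then have "\<bar>y\<bar> \<le> (1 + \<bar>x0\<bar>) * (1 + (y - x0))" using True by (simp add: algebra_simps)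
      then have "\<bar>y\<bar> ^ Suc m \<le> ((1 + \<bar>x0\<bar>) * (1 + (y - x0))) ^ Suc m" by (intro power_mono) auto
      also have "\<dots> = K * (1 + (y - x0)) ^ Suc m" unfolding K_def by (rule power_mult_distrib)
      also have "(1 + (y - x0)) ^ Suc m = Suc m * W (y - x0) + 1" unfolding W_def by simp
      finally have "ennreal (\<bar>y\<bar> ^ Suc m) \<le> ennreal (K * (Suc m * W (y - x0) + 1))" by (rule ennreal_leI)
      also have "K * (Suc m * W (y - x0) + 1) = K * Suc m * W (y - x0) + K" by (simp add: distrib_left)
      also have "0 \<le> W (y - x0)"
        unfolding W_def using True one_le_power[of "1 + (y - x0)" "Suc m"] by (simp del: power_Suc)
      then have "ennreal (K * Suc m * W (y - x0) + K) = ennreal (K * Suc m) * ennreal (W (y - x0)) + ennreal K"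
        using K by (subst ennreal_plus) (auto simp: ennreal_mult)
      finally show ?thesis using True by simp
    qed simp
  qed
  also have "\<dots> = ennreal (K * Suc m) * (\<integral>\<^sup>+y. ennreal (W (y - x0)) * indicator {x0..} y \<partial>M) + ennreal K"
    using M.emeasure_space_1 by (subst nn_integral_add) (auto simp: nn_integral_cmult)
  also have "\<dots> < \<infinity>" using fin by (simp add: ennreal_mult_less_top)
  finally show ?thesis .
qed

section \<open>Continuous distribution functions\<close>

lemma isCont_if_lipschitz:
  fixes f :: "real \<Rightarrow> real"
  assumes lip: "\<And>x y. \<bar>f x - f y\<bar> \<le> K * \<bar>x - y\<bar>"
  shows "isCont f x"
proof -
  have "K-lipschitz_on UNIV f"
    using lip[of 0 1] lip by (intro lipschitz_onI) (auto simp: dist_real_def)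
  then show ?thesis
    by (metis lipschitz_on_continuous_on continuous_on_eq_continuous_at open_UNIV UNIV_I)
qed

context cdf_distribution begin

lemma measurable_quantile[measurable]: "I \<in> borel_measurable (restrict_space lborel {0<..<1})"
  using measurable_CI measurable_cong_sets[OF sets_restrict_space_cong[OF sets_lborel] refl] by blast

text \<open>
  To the left of the quantile \<open>I w\<close> all values of \<open>C\<close> are below \<open>w\<close>; continuity carries the bound to \<open>I w\<close>
  itself.
\<close>

lemma cdf_quantile:
  assumes cont: "\<And>x. isCont C x" and w: "0 < w" "w < 1"
  shows "C (I w) = w"
proof (rule antisym)
  show "w \<le> C (I w)" using pseudoinverse[OF w, of "I w"] by simp
  have "\<forall>\<^sub>F y in at_left (I w). C y \<le> w"
    unfolding eventually_at_filter
  proof (intro always_eventually allI impI)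
    fix y assume "y \<in> {..<I w}"
    then have "\<not> I w \<le> y" by simp
    then show "C y \<le> w" using pseudoinverse[OF w, of y] by linarith
  qed
  moreover have "(C \<longlongrightarrow> C (I w)) (at_left (I w))"
    using cont by (simp add: isCont_def filterlim_at_split)
  ultimately show "C (I w) \<le> w"
    by (intro tendsto_upperbound) auto
qed

text \<open>
  A continuous distribution function maps its own law to the uniform law on \<open>(0, 1)\<close>; the law itself is
  the image of the uniform law under the quantile function.
\<close>

lemma nn_integral_comp_cdf:
  assumes cont: "\<And>x. isCont C x" and f[measurable]: "f \<in> borel_measurable borel"
  shows "(\<integral>\<^sup>+y. f (C y) * indicator {..x} y \<partial>M) = (\<integral>\<^sup>+w. f w * indicator {0<..<1} w * indicator {..C x} w \<partial>lborel)"
proof -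
  have "(\<integral>\<^sup>+y. f (C y) * indicator {..x} y \<partial>M) =
     (\<integral>\<^sup>+y. f (C y) * indicator {..x} y \<partial>distr (restrict_space lborel {0<..<1}) borel I)"
    by (simp add: distr_I_eq_M)
  also have "\<dots> = (\<integral>\<^sup>+w. f (C (I w)) * indicator {..x} (I w) \<partial>restrict_space lborel {0<..<1})"
    by (intro nn_integral_distr) measurable
  also have "\<dots> = (\<integral>\<^sup>+w. f (C (I w)) * indicator {..x} (I w) * indicator {0<..<1} w \<partial>lborel)"
    by (rule nn_integral_restrict_space) simp
  also have "\<dots> = (\<integral>\<^sup>+w. f w * indicator {0<..<1} w * indicator {..C x} w \<partial>lborel)"
  proof (rule nn_integral_cong)
    fix w
    show "f (C (I w)) * indicator {..x} (I w) * indicator {0<..<1} w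
      = f w * indicator {0<..<1} w * indicator {..C x} w"
    proof (cases "0 < w \<and> w < 1")
      case True
      then have iff: "I w \<le> x \<longleftrightarrow> w \<le> C x" by (intro pseudoinverse[symmetric]) auto
      have eq: "C (I w) = w" using True by (intro cdf_quantile[OF cont]) auto
      show ?thesis unfolding eq indicator_def atMost_iff iff by (rule mult.commute[THEN trans]) (simp only: ac_simps)
    next
      case False
      then have "indicator {0<..<1} w = (0 :: ennreal)" by (auto simp: indicator_def)
      then show ?thesis by (simp only: mult_zero_left mult_zero_right)
    qed
  qed
  finally show ?thesis .
qed

text \<open>
  The mass of a set \<open>A\<close> is the Lebesgue measure of the levels whose quantile lies in \<open>A\<close>. These levels
  lie in the image of \<open>A\<close> under the distribution function, and Lipschitz maps preserve null sets.
\<close>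

lemma absolutely_continuous_lipschitz_cdf:
  assumes lip: "\<And>x y. \<bar>C x - C y\<bar> \<le> K * \<bar>x - y\<bar>"
  shows "absolutely_continuous lborel M"
  unfolding absolutely_continuous_def
proof
  fix A :: "real set" assume A: "A \<in> null_sets lborel"
  have cont: "isCont C x" for x by (rule isCont_if_lipschitz[OF lip])
  have "negligible (C ` A)"
  proof (rule negligible_locally_Lipschitz_image)
    show "negligible A" using A by (simp add: negligible_iff_null_sets null_sets_completionI)
    show "\<exists>T B. open T \<and> x \<in> T \<and> (\<forall>y\<in>A \<inter> T. norm (C y - C x) \<le> B * norm (y - x))" for x
      using lip by (intro exI[of _ UNIV] exI[of _ K]) auto
  qed simp
  then have "C ` A \<in> null_sets (completion lborel)" by (simp add: negligible_iff_null_sets)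
  then have "\<exists>B\<in>null_sets lborel. C ` A \<subseteq> B" by (simp only: null_sets_completion_iff2)
  then obtain B where B: "B \<in> null_sets lborel" "C ` A \<subseteq> B" ..
  have [measurable]: "A \<in> sets borel" "B \<in> sets borel" using A B by auto
  have "emeasure M A = emeasure (distr (restrict_space lborel {0<..<1}) borel I) A"
    by (simp add: distr_I_eq_M)
  also have "\<dots> = emeasure (restrict_space lborel {0<..<1}) {w \<in> {0<..<1}. I w \<in> A}"
    by (subst emeasure_distr) (auto simp: space_restrict_space intro!: arg_cong2[where f=emeasure])
  also have "\<dots> \<le> emeasure (restrict_space lborel {0<..<1}) (B \<inter> {0<..<1})"
  proof (rule emeasure_mono)
    show "{w \<in> {0<..<1}. I w \<in> A} \<subseteq> B \<inter> {0<..<1}"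
    proof
      fix w assume "w \<in> {w \<in> {0<..<1}. I w \<in> A}"
      then have "0 < w" "w < 1" "C (I w) \<in> B" using B(2) by auto
      then show "w \<in> B \<inter> {0<..<1}" using cdf_quantile[OF cont, of w] by simp
    qed
  qed (auto simp: sets_restrict_space)
  also have "\<dots> = emeasure lborel (B \<inter> {0<..<1})"
    by (rule emeasure_restrict_space) auto
  also have "\<dots> \<le> emeasure lborel B" by (rule emeasure_mono) auto
  also have "\<dots> = 0" using B by auto
  finally show "A \<in> null_sets M" using A by (auto simp: null_sets_def)
qed

lemma measure_Icc_cdf:
  assumes "isCont C a" "a \<le> b"
  shows "measure M {a..b} = C b - C a"
proof -
  have eq: "{a..b} = {a} \<union> {a<..b}" using assms(2) by auto
  have "measure M {a..b} = measure M {a} + measure M {a<..b}"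
    unfolding eq by (rule finite_measure_Union) auto
  then show ?thesis
    using assms isCont_cdf[of a] cdf_diff_eq[of a b] by (cases "a = b") auto
qed

text \<open>
  Lebesgue differentiation of the Radon-Nikodym density. Everything is reflected at 0 because
  the differentiation theorem gives right derivatives of indefinite integrals, whereas the equation of the model
  at time 0 concerns left derivatives of the shape.
\<close>

lemma lipschitz_cdf_density:
  assumes lip: "\<And>x y. \<bar>C x - C y\<bar> \<le> K * \<bar>x - y\<bar>"
  shows "\<exists>p. p \<in> borel_measurable borel \<and> (\<forall>x. 0 \<le> p x) \<and> M = density lborel (\<lambda>x. ennreal (p x)) \<and>
    (AE x in lborel. ((\<lambda>s. (C (- x) - C (- x - s)) / s) \<longlongrightarrow> p (- x)) (at_right 0))"
proof -
  have cont: "isCont C x" for x by (rule isCont_if_lipschitz[OF lip])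
  have ac: "absolutely_continuous lborel M" by (rule absolutely_continuous_lipschitz_cdf[OF lip])
  have sets: "sets M = sets lborel" by (simp add: M_is_borel)
  obtain p where p: "p \<in> borel_measurable lborel" "AE x in lborel. RN_deriv lborel M x = ennreal (p x)" "\<And>x. 0 \<le> p x"
    using sigma_finite_measure.real_RN_deriv[OF sigma_finite_lborel finite_measure_axioms ac sets] by blast
  have [measurable]: "p \<in> borel_measurable borel" using p(1) by simp
  have "density lborel (RN_deriv lborel M) = M" by (rule sigma_finite_measure.density_RN_deriv[OF sigma_finite_lborel ac sets])
  moreover have "density lborel (RN_deriv lborel M) = density lborel (\<lambda>x. ennreal (p x))"
    by (rule density_cong) (use p in auto)
  ultimately have M: "M = density lborel (\<lambda>x. ennreal (p x))" by simp
  have "(\<integral>\<^sup>+x. ennreal (p x) \<partial>lborel) = emeasure (density lborel (\<lambda>x. ennreal (p x))) UNIV"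
    by (simp add: emeasure_density)
  also have "\<dots> = 1" using emeasure_space_1 by (simp add: M[symmetric])
  finally have "integrable lborel p"
    using p(3) by (intro integrableI_nonneg) auto
  then have "integrable lborel (\<lambda>x. p (0 + (- 1) * x))" by (rule lborel_integrable_real_affine) simp
  then have "integrable lborel (\<lambda>x. p (- x))" by simp
  then have "(\<lambda>x. p (- x)) integrable_on UNIV" by (rule integrable_on_lborel)
  then have int: "(\<lambda>x. p (- x)) integrable_on cbox a b" for a b
    by (rule integrable_on_subcbox) simp
  have ftc: "integral {y..y + s} (\<lambda>x. p (- x)) = C (- y) - C (- y - s)" if "0 < s" for y s
  proof -
    have "((\<lambda>x. if x \<in> {y..y + s} then p (- x) else 0) has_integral integral {y..y + s} (\<lambda>x. p (- x))) UNIV"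
      unfolding has_integral_restrict_UNIV using int[of y "y + s"] by (simp add: integrable_integral)
    then have "ennreal (integral {y..y + s} (\<lambda>x. p (- x))) = (\<integral>\<^sup>+x. ennreal (if x \<in> {y..y + s} then p (- x) else 0) \<partial>lborel)"
      using p(3) by (intro nn_integral_has_integral_lborel[symmetric]) auto
    also have "\<dots> = (\<integral>\<^sup>+x. ennreal (if - x \<in> {y..y + s} then p x else 0) \<partial>lborel)"
      by (subst nn_integral_real_affine[where c="-1" and t=0]) (simp_all cong: if_cong)
    also have "\<dots> = (\<integral>\<^sup>+x. ennreal (p x) * indicator {- y - s..- y} x \<partial>lborel)"
      by (intro nn_integral_cong) (auto split: split_indicator)
    also have "\<dots> = emeasure (density lborel (\<lambda>x. ennreal (p x))) {- y - s..- y}"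
      by (simp add: emeasure_density)
    also have "\<dots> = emeasure M {- y - s..- y}" by (simp only: M[symmetric])
    also have "\<dots> = ennreal (C (- y) - C (- y - s))"
      using measure_Icc_cdf[OF cont, of "- y - s" "- y"] that by (simp add: emeasure_eq_measure)
    finally show ?thesis
      using that p(3) int[of y "y + s"]
      by (subst (asm) ennreal_inj) (auto intro!: Henstock_Kurzweil_Integration.integral_nonneg cdf_nondecreasing)
  qed
  obtain Z where Z: "negligible Z"
    "\<And>x e. \<lbrakk>x \<notin> Z; 0 < e\<rbrakk> \<Longrightarrow> \<exists>d>0. \<forall>s. 0 < s \<and> s < d \<longrightarrow>
        norm (integral (cbox x (x + s *\<^sub>R One)) (\<lambda>x. p (- x)) /\<^sub>R s ^ DIM(real) - p (- x)) < e"
    by (rule integrable_ccontinuous_explicit[of "\<lambda>x. p (- x)", OF int]) blast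
  have "((\<lambda>s. (C (- x) - C (- x - s)) / s) \<longlongrightarrow> p (- x)) (at_right 0)" if "x \<notin> Z" for x
  proof (rule tendstoI)
    fix e :: real assume "0 < e"
    from Z(2)[OF that this] obtain d where d: "0 < d" "\<And>s. 0 < s \<Longrightarrow> s < d \<Longrightarrow>
        norm (integral {x..x + s} (\<lambda>x. p (- x)) / s - p (- x)) < e"
      by (auto simp: divide_inverse_commute)
    show "\<forall>\<^sub>F s in at_right 0. dist ((C (- x) - C (- x - s)) / s) (p (- x)) < e"
      unfolding eventually_at_right_field
      using d ftc[of _ x] by (intro exI[of _ d]) (auto simp: dist_real_def)
  qed
  moreover have "AE x in lebesgue. x \<notin> Z"
    using Z(1) by (intro AE_not_in) (simp add: negligible_iff_null_sets)
  ultimately have ae: "AE x in lborel. ((\<lambda>s. (C (- x) - C (- x - s)) / s) \<longlongrightarrow> p (- x)) (at_right 0)"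
    unfolding AE_completion_iff by (rule eventually_mono[rotated]) auto
  show ?thesis
  proof (intro exI[of _ p] conjI allI)
    show "p \<in> borel_measurable borel" by fact
    show "0 \<le> p x" for x by (rule p(3))
    show "M = density lborel (\<lambda>x. ennreal (p x))" by (rule M)
  qed (rule ae)
qed

end

definition continuous_df :: "(real \<Rightarrow> real) \<Rightarrow> bool" where
  "continuous_df \<phi> \<longleftrightarrow> unit_mono \<phi> \<and> (\<forall>x. isCont \<phi> x) \<and> (\<phi> \<longlongrightarrow> 0) at_bot \<and> (\<phi> \<longlongrightarrow> 1) at_top"

lemma continuous_dfD:
  assumes "continuous_df \<phi>"
  shows "unit_mono \<phi>" "isCont \<phi> x" "(\<phi> \<longlongrightarrow> 0) at_bot" "(\<phi> \<longlongrightarrow> 1) at_top"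
  using assms by (auto simp: continuous_df_def)

lemma continuous_df_distribution_function:
  assumes "continuous_df \<phi>"
  shows "distribution_function \<phi>"
  unfolding distribution_function_def rcll_def
proof (intro conjI allI)
  show "mono \<phi>" by (rule unit_monoD(1)[OF continuous_dfD(1)[OF assms]])
  show "\<phi> x \<in> {0..1}" for x using unit_monoD(2,3)[OF continuous_dfD(1)[OF assms]] by simp
  show "continuous (at_right x) \<phi>" for x
    by (rule continuous_at_imp_continuous_at_within[OF continuous_dfD(2)[OF assms]])
  show "\<exists>l. (\<phi> \<longlongrightarrow> l) (at_left x)" for x
    using continuous_dfD(2)[OF assms, of x] by (auto simp: isCont_def filterlim_at_split)
qed (rule continuous_dfD(3,4)[OF assms])+

lemma continuous_df_shift:
  assumes "continuous_df \<phi>"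
  shows "continuous_df (\<lambda>x. \<phi> (x - a))"
  unfolding continuous_df_def
proof (intro conjI allI)
  show "unit_mono (\<lambda>x. \<phi> (x - a))"
    using unit_mono_shift[OF continuous_dfD(1)[OF assms], of "- a"] by simp
  show "isCont (\<lambda>x. \<phi> (x - a)) x" for x
    by (intro isCont_o2[OF _ continuous_dfD(2)[OF assms]] continuous_intros)
  have "filterlim (\<lambda>x. x - a) at_bot at_bot"
    unfolding filterlim_at_bot eventually_at_bot_linorder
    by (intro allI, rule_tac x="Z + a" in exI) auto
  then show "((\<lambda>x. \<phi> (x - a)) \<longlongrightarrow> 0) at_bot" by (rule filterlim_compose[OF continuous_dfD(3)[OF assms]])
  have "filterlim (\<lambda>x. x - a) at_top at_top"
    unfolding filterlim_at_top eventually_at_top_linorder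
    by (intro allI, rule_tac x="Z + a" in exI) auto
  then show "((\<lambda>x. \<phi> (x - a)) \<longlongrightarrow> 1) at_top" by (rule filterlim_compose[OF continuous_dfD(4)[OF assms]])
qed

lemma interval_measure_continuous_df:
  assumes "continuous_df \<phi>"
  shows "cdf_distribution (interval_measure \<phi>)" "cdf (interval_measure \<phi>) = \<phi>"
proof -
  note mono = monoD[OF unit_monoD(1)[OF continuous_dfD(1)[OF assms]]]
  note right = continuous_at_imp_continuous_at_within[OF continuous_dfD(2)[OF assms]]
  have "real_distribution (interval_measure \<phi>)"
    by (rule real_distribution_interval_measure[OF mono right continuous_dfD(3,4)[OF assms]])
  then show "cdf_distribution (interval_measure \<phi>)" by (simp add: cdf_distribution_def)
  show "cdf (interval_measure \<phi>) = \<phi>"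
    by (rule cdf_interval_measure[OF mono right continuous_dfD(3)[OF assms]])
qed

section \<open>The nonlinearity and the jump law of the model\<close>

locale wave_data =
  fixes \<eta> J :: "real \<Rightarrow> real"
  assumes eta_range: "\<eta> ` {0..1} \<subseteq> {0..1}"
    and eta_cont: "continuous_on {0..1} \<eta>"
    and eta_anti: "strict_antimono_on {0..1} \<eta>"
    and eta_0: "\<eta> 0 = 1" and eta_1: "\<eta> 1 = 0"
    and J_cdf: "cdf_on_nonneg J"
    and J_moment: "has_moment J 1" and J_mean: "moment J 1 > 0"
begin

definition H :: "real \<Rightarrow> real" where "H u = integral {0..u} \<eta>"

abbreviation "eta_mass \<equiv> integral {0..1} \<eta>"

definition h :: "real \<Rightarrow> real" where "h u = H u / eta_mass"

lemma eta_less: "0 \<le> a \<Longrightarrow> a < b \<Longrightarrow> b \<le> 1 \<Longrightarrow> \<eta> b < \<eta> a"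
  using eta_anti unfolding monotone_on_def by auto

lemma eta_le: "0 \<le> a \<Longrightarrow> a \<le> b \<Longrightarrow> b \<le> 1 \<Longrightarrow> \<eta> b \<le> \<eta> a"
  using eta_less[of a b] by (cases "a = b") auto

lemma eta_bounds: "0 \<le> a \<Longrightarrow> a \<le> 1 \<Longrightarrow> 0 \<le> \<eta> a \<and> \<eta> a \<le> 1"
  using subsetD[OF eta_range imageI[of a "{0..1}" \<eta>]] by simp

lemma eta_integrable: "0 \<le> a \<Longrightarrow> b \<le> 1 \<Longrightarrow> \<eta> integrable_on {a..b}"
  by (rule integrable_continuous_real, rule continuous_on_subset[OF eta_cont]) auto

text \<open>
  As \<open>\<eta>\<close> decreases, its integral over \<open>[a, b]\<close> lies between the areas of the two extreme rectangles.
  All concavity properties of \<open>h\<close> follow from these bounds.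
\<close>

lemma H_diff:
  assumes "0 \<le> a" "a \<le> b" "b \<le> 1"
  shows "(b - a) * \<eta> b \<le> H b - H a" "H b - H a \<le> (b - a) * \<eta> a"
proof -
  have "integral {0..a} \<eta> + integral {a..b} \<eta> = integral {0..b} \<eta>"
    using assms by (intro Henstock_Kurzweil_Integration.integral_combine eta_integrable) auto
  then have eq: "H b - H a = integral {a..b} \<eta>" by (simp add: H_def)
  have "integral {a..b} (\<lambda>_. \<eta> b) \<le> integral {a..b} \<eta>"
    using assms by (intro integral_le eta_integrable eta_le) auto
  then show "(b - a) * \<eta> b \<le> H b - H a" using assms eq by simp
  have "integral {a..b} \<eta> \<le> integral {a..b} (\<lambda>_. \<eta> a)"
    using assms by (intro integral_le eta_integrable eta_le) auto
  then show "H b - H a \<le> (b - a) * \<eta> a" using assms eq by simp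
qed

lemma H_0: "H 0 = 0" by (simp add: H_def)

lemma H_1: "H 1 = eta_mass" by (simp add: H_def)

text \<open>
  Splitting \<open>[u, 1]\<close> at an interior point makes the upper rectangle bound for \<open>H 1 - H u\<close> strict.
\<close>

lemma H_strict:
  assumes "0 < u" "u < 1"
  shows "u * eta_mass < H u"
proof -
  define w where "w = (1 + u) / 2"
  have w: "u < w" "w < 1" using assms by (auto simp: w_def)
  have "eta_mass - H u = (H 1 - H w) + (H w - H u)" by (simp add: H_1)
  also have "\<dots> \<le> (1 - w) * \<eta> w + (w - u) * \<eta> u"
    using H_diff(2)[of w 1] H_diff(2)[of u w] assms w by simp
  also have "\<dots> < (1 - w) * \<eta> u + (w - u) * \<eta> u"
    using eta_less[of u w] assms w by simp
  also have "\<dots> = (1 - u) * \<eta> u" by (simp add: algebra_simps)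
  finally have "u * (eta_mass - H u) < u * ((1 - u) * \<eta> u)" using assms by simp
  moreover have "(1 - u) * (u * \<eta> u) \<le> (1 - u) * H u"
    using H_diff(1)[of 0 u] assms by (intro mult_left_mono) (auto simp: H_0)
  ultimately show ?thesis by (simp add: algebra_simps)
qed

lemma eta_mass_pos: "0 < eta_mass"
proof -
  have "1 / 2 * \<eta> (1 / 2) \<le> H (1 / 2)" using H_diff(1)[of 0 "1 / 2"] by (simp add: H_0)
  moreover have "H (1 / 2) \<le> eta_mass"
    using H_diff(1)[of "1 / 2" 1] by (simp add: H_1 eta_1)
  moreover have "0 < \<eta> (1 / 2)" using eta_less[of "1 / 2" 1] by (simp add: eta_1)
  ultimately show ?thesis by simp
qed

lemma H_mono: "0 \<le> a \<Longrightarrow> a \<le> b \<Longrightarrow> b \<le> 1 \<Longrightarrow> H a \<le> H b"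
  using H_diff(1)[of a b] eta_bounds[of b] mult_nonneg_nonneg[of "b - a" "\<eta> b"] by linarith

lemma monostable_h: "monostable h"
  unfolding monostable_def
proof (intro conjI allI impI)
  show "mono_on {0..1} h"
    using H_mono eta_mass_pos by (auto simp: mono_on_def h_def divide_right_mono)
  have "continuous_on {0..1} H"
    unfolding H_def[abs_def] by (rule indefinite_integral_continuous_1[OF eta_integrable]) auto
  then show "continuous_on {0..1} h" unfolding h_def[abs_def] using eta_mass_pos by (intro continuous_intros) auto
  show "h 0 = 0" "h 1 = 1" using eta_mass_pos by (simp_all add: h_def H_0 H_1)
  show "u < h u" if "0 < u \<and> u < 1" for u
    using H_strict[of u] that eta_mass_pos by (simp add: h_def pos_less_divide_eq)
qed

lemma star_shaped_h: "star_shaped h"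
  unfolding star_shaped_def
proof (intro allI impI)
  fix u v :: real assume uv: "0 < u \<and> u \<le> v \<and> v \<le> 1"
  have "H v - H u \<le> (v - u) * \<eta> u" "u * \<eta> u \<le> H u"
    using H_diff(2)[of u v] H_diff(1)[of 0 u] uv by (auto simp: H_0)
  then have "u * (H v - H u) \<le> u * ((v - u) * \<eta> u)" "(v - u) * (u * \<eta> u) \<le> (v - u) * H u"
    using uv by (auto intro: mult_left_mono)
  then have "u * H v \<le> v * H u" by (simp add: algebra_simps)
  then show "u * h v \<le> v * h u" using eta_mass_pos by (simp add: h_def divide_right_mono)
qed

text \<open>
  The left derivative of \<open>h\<close> at 1 is proportional to \<open>\<eta> 1 = 0\<close>.
\<close>

lemma h_flat_at_1:
  assumes "0 < \<epsilon>"
  shows "\<exists>\<delta>>0. \<forall>v. 0 \<le> v \<and> 1 - \<delta> \<le> v \<and> v \<le> 1 \<longrightarrow> 1 - h v \<le> \<epsilon> * (1 - v)"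
proof -
  obtain d where d: "0 < d" "\<And>v. 0 \<le> v \<Longrightarrow> v \<le> 1 \<Longrightarrow> dist v 1 < d \<Longrightarrow> dist (\<eta> v) (\<eta> 1) < \<epsilon> * eta_mass"
    using eta_cont assms eta_mass_pos unfolding continuous_on_iff by (metis atLeastAtMost_iff mult_pos_pos order_refl zero_le_one)
  have "1 - h v \<le> \<epsilon> * (1 - v)" if v: "0 \<le> v \<and> 1 - d / 2 \<le> v \<and> v \<le> 1" for v
  proof -
    have "\<eta> v \<le> \<epsilon> * eta_mass" using d(2)[of v] v d(1) by (auto simp: dist_real_def eta_1)
    then have "(1 - v) * \<eta> v \<le> (1 - v) * (\<epsilon> * eta_mass)" using v by (intro mult_left_mono) auto
    then have "eta_mass - H v \<le> (1 - v) * (\<epsilon> * eta_mass)" using H_diff(2)[of v 1] v by (simp add: H_1)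
    then have "(eta_mass - H v) / eta_mass \<le> (1 - v) * \<epsilon>" using eta_mass_pos by (simp add: pos_divide_le_eq)
    then show ?thesis using eta_mass_pos by (simp add: h_def diff_divide_distrib mult.commute)
  qed
  then show ?thesis using d(1) by (intro exI[of _ "d / 2"]) auto
qed

definition D :: "real measure" where "D = interval_measure J"

lemma D: "real_distribution D" "cdf D = J"
proof -
  obtain M where M: "real_distribution M" "J = cdf M"
    using J_cdf by (auto simp: cdf_on_nonneg_def)
  interpret M: real_distribution M by fact
  have D_M: "D = interval_measure (cdf M)" unfolding D_def using M(2) by simp
  have 1: "real_distribution D" unfolding D_M
    by (intro real_distribution_interval_measure M.cdf_nondecreasing M.cdf_is_right_cont
        M.cdf_lim_at_bot M.cdf_lim_at_top_prob)
  have 2: "cdf D = cdf M" unfolding D_M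
    by (intro cdf_interval_measure M.cdf_nondecreasing M.cdf_is_right_cont M.cdf_lim_at_bot)
  have "D = M" by (rule cdf_unique[OF 1 M(1) 2])
  with 1 M show "real_distribution D" "cdf D = J" by auto
qed

sublocale D: real_distribution D by (rule D)

abbreviation "mean \<equiv> moment J 1"

text \<open>
  Cut off at 0, since \<open>1 - J\<close> equals 1 on the negative half-line.
\<close>

definition tail :: "real \<Rightarrow> real" where "tail z = indicator {0..} z * (1 - J z)"

lemma J_bounds: "0 \<le> J z" "J z \<le> 1"
  using D.cdf_nonneg[of z] D.cdf_bounded_prob[of z] by (simp_all add: D(2))

lemma J_mono: "mono J"
  using D.cdf_nondecreasing by (auto simp: mono_def D(2))

lemma tail_bounds: "0 \<le> tail z" "tail z \<le> 1"
  using J_bounds[of z] by (auto simp: tail_def indicator_def)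

lemma J_measurable[measurable]: "J \<in> borel_measurable borel"
  by (rule borel_measurable_mono[OF J_mono])

lemma tail_measurable[measurable]: "tail \<in> borel_measurable borel"
  unfolding tail_def[abs_def] by measurable

lemma tail_discont: "countable {z. \<not> isCont tail z}"
proof (rule countable_subset)
  show "{z. \<not> isCont tail z} \<subseteq> {0} \<union> {z. \<not> isCont J z}"
  proof
    fix z assume z: "z \<in> {z. \<not> isCont tail z}"
    show "z \<in> {0} \<union> {z. \<not> isCont J z}"
    proof (rule ccontr)
      assume "z \<notin> {0} \<union> {z. \<not> isCont J z}"
      then have nz: "z \<noteq> 0" and cont: "isCont J z" by auto
      have "isCont (indicator {0..} :: real \<Rightarrow> real) z"
        using nz by (simp add: isCont_indicator)
      then have "isCont tail z"
        unfolding tail_def[abs_def] using cont by (intro continuous_intros)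
      with z show False by simp
    qed
  qed
  show "countable ({0} \<union> {z. \<not> isCont J z})" using mono_ctble_discont[OF J_mono] by simp
qed

lemma D_tail: "emeasure D {x<..} = ennreal (1 - J x)"
proof -
  have "D.prob {x<..} = 1 - D.prob {..x}"
    using D.prob_compl[of "{..x}"] by (simp add: Compl_eq_Diff_UNIV[symmetric])
  also have "D.prob {..x} = J x" using fun_cong[OF D(2), of x] by (simp only: cdf_def)
  finally show ?thesis by (simp add: D.emeasure_eq_measure)
qed

lemma nn_integral_tail:
  assumes "\<And>x. 0 \<le> x \<Longrightarrow> (W has_real_derivative w x) (at x)"
    and "\<And>x. 0 \<le> x \<Longrightarrow> 0 \<le> w x" "w \<in> borel_measurable borel" "W 0 = 0"
  shows "(\<integral>\<^sup>+x. ennreal (w x) * ennreal (tail x) \<partial>lborel) = (\<integral>\<^sup>+y. ennreal (W y) * indicator {0..} y \<partial>D)"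
proof -
  have "(\<integral>\<^sup>+x. ennreal (w x) * ennreal (tail x) \<partial>lborel) =
    (\<integral>\<^sup>+x. ennreal (w x) * indicator {0..} x * emeasure D {0 + x<..} \<partial>lborel)"
    by (intro nn_integral_cong) (auto simp: tail_def D_tail split: split_indicator)
  also have "\<dots> = (\<integral>\<^sup>+y. ennreal (W (y - 0)) * indicator {0..} y \<partial>D)"
    by (rule layer_cake[OF D.finite_borel_measure_M assms])
  finally show ?thesis by simp
qed

lemma nn_integral_power_D:
  assumes "has_moment J k"
  shows "(\<integral>\<^sup>+y. ennreal (y ^ k) * indicator {0..} y \<partial>D) = ennreal (moment J k)"
proof -
  have "(\<integral>\<^sup>+y. ennreal (indicator {0..} y * y ^ k) \<partial>D) = ennreal (\<integral>y. indicator {0..} y * y ^ k \<partial>D)"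
    using assms unfolding has_moment_def set_integrable_def D_def[symmetric]
    by (intro nn_integral_eq_integral) (auto simp: indicator_def)
  also have "(\<integral>y. indicator {0..} y * y ^ k \<partial>D) = moment J k"
    by (simp add: moment_def set_lebesgue_integral_def D_def)
  also have "(\<integral>\<^sup>+y. ennreal (indicator {0..} y * y ^ k) \<partial>D) = (\<integral>\<^sup>+y. ennreal (y ^ k) * indicator {0..} y \<partial>D)"
    by (intro nn_integral_cong) (auto split: split_indicator)
  finally show ?thesis .
qed

lemma nn_integral_tail_eq_mean: "(\<integral>\<^sup>+x. ennreal (tail x) \<partial>lborel) = ennreal mean"
proof -
  have "(\<integral>\<^sup>+x. ennreal 1 * ennreal (tail x) \<partial>lborel) = (\<integral>\<^sup>+y. ennreal y * indicator {0..} y \<partial>D)"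
    by (rule nn_integral_tail) auto
  then show ?thesis using nn_integral_power_D[OF J_moment] by simp
qed

text \<open>
  The stationary excess law of the jumps, known from renewal theory.
\<close>

definition N :: "real measure" where "N = density lborel (\<lambda>z. ennreal (tail z / mean))"

lemma nn_integral_N:
  assumes [measurable]: "f \<in> borel_measurable borel"
  shows "ennreal mean * (\<integral>\<^sup>+z. f z \<partial>N) = (\<integral>\<^sup>+z. ennreal (tail z) * f z \<partial>lborel)"
proof -
  have "ennreal mean * (\<integral>\<^sup>+z. f z \<partial>N) = (\<integral>\<^sup>+z. ennreal mean * (ennreal (tail z / mean) * f z) \<partial>lborel)"
    unfolding N_def by (subst nn_integral_density) (auto simp: nn_integral_cmult)
  also have "\<dots> = (\<integral>\<^sup>+z. ennreal (tail z) * f z \<partial>lborel)"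
    using J_mean tail_bounds(1)
    by (intro nn_integral_cong) (simp add: mult.assoc[symmetric] ennreal_mult[symmetric])
  finally show ?thesis .
qed

sublocale N: jump_law N
proof -
  have "ennreal mean * emeasure N UNIV = ennreal mean * 1"
    using nn_integral_N[of "\<lambda>_. 1"] nn_integral_tail_eq_mean by (simp add: N_def)
  then have "emeasure N UNIV = 1"
    using J_mean by (subst (asm) ennreal_mult_cancel_left) auto
  then have "prob_space N" by (intro prob_spaceI) (simp add: N_def)
  then interpret prob_space N .
  show "jump_law N"
  proof (unfold_locales)
    show "sets N = sets borel" by (simp add: N_def)
    show "measure N {z} = 0" for z
      unfolding N_def measure_def
      by (subst emeasure_density) (auto simp: nn_integral_indicator_singleton)
    show "AE z in N. 0 \<le> z"
      unfolding N_def by (subst AE_density) (auto simp: tail_def indicator_def)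
  qed
qed

text \<open>
  Integrating the tail of the jump law against a power raises the exponent by one, so moments of order
  \<open>m + 2\<close> of the jumps control moments of order \<open>m + 1\<close> of \<open>N\<close>.
\<close>

lemma nn_integral_weight_N:
  assumes "\<forall>k\<in>{1..Suc (Suc m)}. has_moment J k"
  shows "(\<integral>\<^sup>+z. ennreal ((1 + z) ^ Suc m) * indicator {0..} z \<partial>N) < \<infinity>"
proof -
  define n where "n = Suc (Suc m)"
  have "ennreal mean * (\<integral>\<^sup>+z. ennreal ((1 + z) ^ Suc m) * indicator {0..} z \<partial>N)
    = (\<integral>\<^sup>+z. ennreal ((1 + z) ^ Suc m) * ennreal (tail z) \<partial>lborel)"
    by (subst nn_integral_N) (auto simp: tail_def ac_simps intro!: nn_integral_cong split: split_indicator)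
  also have "\<dots> = (\<integral>\<^sup>+y. ennreal (((1 + y) ^ n - 1) / n) * indicator {0..} y \<partial>D)"
  proof (rule nn_integral_tail)
    show "((\<lambda>x. ((1 + x) ^ n - 1) / real n) has_real_derivative (1 + x) ^ Suc m) (at x)" for x :: real
      unfolding n_def by (auto intro!: derivative_eq_intros simp del: power_Suc)
  qed auto
  also have "\<dots> \<le> (\<integral>\<^sup>+y. ennreal (2 ^ n) + ennreal (2 ^ n) * (ennreal (y ^ n) * indicator {0..} y) \<partial>D)"
  proof (rule nn_integral_mono)
    fix y :: real
    show "ennreal (((1 + y) ^ n - 1) / n) * indicator {0..} y \<le> ennreal (2 ^ n) + ennreal (2 ^ n) * (ennreal (y ^ n) * indicator {0..} y)"
    proof (cases "0 \<le> y")
      case True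
      have "0 \<le> (1 + y) ^ n - 1" using True one_le_power[of "1 + y" n] by simp
      then have "((1 + y) ^ n - 1) / n \<le> ((1 + y) ^ n - 1) / 1"
        by (intro divide_left_mono) (simp_all add: n_def)
      also have "\<dots> \<le> (1 + y) ^ n" by simp
      also have "\<dots> \<le> (2 * max 1 y) ^ n" using True by (intro power_mono) auto
      also have "\<dots> = 2 ^ n * (max 1 y) ^ n" by (rule power_mult_distrib)
      also have "max 1 y ^ n \<le> 1 + y ^ n" using True by (cases "1 \<le> y") (auto simp: max_def)
      finally have "((1 + y) ^ n - 1) / n \<le> 2 ^ n * 1 + 2 ^ n * y ^ n" by (simp add: distrib_left)
      then have "ennreal (((1 + y) ^ n - 1) / n) \<le> ennreal (2 ^ n * 1 + 2 ^ n * y ^ n)" by (rule ennreal_leI)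
      also have "\<dots> = ennreal (2 ^ n) + ennreal (2 ^ n) * ennreal (y ^ n)"
        using True by (subst ennreal_plus) (auto simp: ennreal_mult)
      finally show ?thesis using True by simp
    qed simp
  qed
  also have "\<dots> = ennreal (2 ^ n) + ennreal (2 ^ n) * (\<integral>\<^sup>+y. ennreal (y ^ n) * indicator {0..} y \<partial>D)"
    using D.emeasure_space_1 by (subst nn_integral_add) (auto simp: nn_integral_cmult)
  also have "\<dots> < \<infinity>"
    using nn_integral_power_D[of n] assms by (simp add: n_def ennreal_mult_less_top del: power_Suc)
  finally show ?thesis
    using J_mean by (auto simp: ennreal_mult_less_top)
qed

end

section \<open>Fixed points and traveling wave shapes\<close>

context wave_data begin

text \<open>
  A continuous extension of \<open>\<eta>\<close> to the whole line, so that integrals can be transported along \<open>\<phi>\<close> by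
  formulas for Borel functions.
\<close>

definition clamped_eta :: "real \<Rightarrow> real" where "clamped_eta w = \<eta> (max 0 (min 1 w))"

lemma clamped_eta_eq: "0 \<le> w \<Longrightarrow> w \<le> 1 \<Longrightarrow> clamped_eta w = \<eta> w"
  by (simp add: clamped_eta_def)

lemma clamped_eta_bounds: "0 \<le> clamped_eta w" "clamped_eta w \<le> 1"
  using eta_bounds[of "max 0 (min 1 w)"] by (auto simp: clamped_eta_def)

lemma clamped_eta_measurable[measurable]: "clamped_eta \<in> borel_measurable borel"
proof -
  have "continuous_on UNIV clamped_eta"
    unfolding clamped_eta_def[abs_def]
    by (rule continuous_on_compose2[OF eta_cont]) (auto intro!: continuous_intros)
  then show ?thesis by (rule borel_measurable_continuous_onI)
qed

lemma nn_integral_clamped_eta: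
  assumes "0 \<le> u" "u \<le> 1"
  shows "(\<integral>\<^sup>+w. ennreal (clamped_eta w) * indicator {0<..<1} w * indicator {..u} w \<partial>lborel) = ennreal (H u)"
proof -
  have "(\<eta> has_integral H u) {0..u}"
    unfolding H_def using assms by (intro integrable_integral eta_integrable) auto
  then have "(clamped_eta has_integral H u) {0..u}"
    by (rule has_integral_eq[rotated]) (use assms in \<open>auto simp: clamped_eta_eq\<close>)
  then have "((\<lambda>w. if w \<in> {0..u} then clamped_eta w else 0) has_integral H u) UNIV"
    unfolding has_integral_restrict_UNIV .
  then have "(\<integral>\<^sup>+w. ennreal (if w \<in> {0..u} then clamped_eta w else 0) \<partial>lborel) = ennreal (H u)"
    by (intro nn_integral_has_integral_lborel) (auto simp: clamped_eta_bounds)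
  moreover have "(\<integral>\<^sup>+w. ennreal (clamped_eta w) * indicator {0<..<1} w * indicator {..u} w \<partial>lborel)
    = (\<integral>\<^sup>+w. ennreal (if w \<in> {0..u} then clamped_eta w else 0) \<partial>lborel)"
  proof (rule nn_integral_cong_AE)
    show "AE w in lborel. ennreal (clamped_eta w) * indicator {0<..<1} w * indicator {..u} w
       = ennreal (if w \<in> {0..u} then clamped_eta w else 0)"
      using AE_lborel_singleton[of 0] AE_lborel_singleton[of 1]
      by eventually_elim (use assms in \<open>auto simp: indicator_def\<close>)
  qed
  ultimately show ?thesis by simp
qed

text \<open>
  The integral in the equation of the model, as a convolution over the whole line.
\<close>

definition flux :: "(real \<Rightarrow> real) \<Rightarrow> real \<Rightarrow> real" where
  "flux \<phi> x = (\<integral>y. clamped_eta (\<phi> y) * tail (x - y) \<partial>interval_measure \<phi>)"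

lemma flux_eq:
  assumes "continuous_df \<phi>"
  shows "flux \<phi> x = (LINT y:{..x}|interval_measure \<phi>. eta_bar \<eta> y \<phi> * (1 - J (x - y)))"
  unfolding flux_def set_lebesgue_integral_def
  by (intro Bochner_Integration.integral_cong)
    (auto simp: eta_bar_def continuous_dfD(2)[OF assms] clamped_eta_eq tail_def
      unit_monoD(2,3)[OF continuous_dfD(1)[OF assms]] split: split_indicator)

lemma flux_product_bounds: "0 \<le> clamped_eta u * tail z" "clamped_eta u * tail z \<le> 1"
  by (intro mult_nonneg_nonneg mult_le_one clamped_eta_bounds tail_bounds)+

context
  fixes \<phi> assumes phi: "continuous_df \<phi>"
begin

interpretation M: cdf_distribution "interval_measure \<phi>"
  by (rule interval_measure_continuous_df[OF phi])

lemma phi_bounds: "0 \<le> \<phi> x" "\<phi> x \<le> 1"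
  using unit_monoD(2,3)[OF continuous_dfD(1)[OF phi]] by auto

lemma phi_measurable[measurable]: "\<phi> \<in> borel_measurable borel"
  by (rule unit_mono_measurable[OF continuous_dfD(1)[OF phi]])

lemma flux_isCont: "isCont (flux \<phi>) x"
  unfolding flux_def[abs_def]
proof (rule M.isCont_convolution[where B=1 and C=1])
  show "measure (interval_measure \<phi>) {z} = 0" for z
    using M.isCont_cdf[of z] continuous_dfD(2)[OF phi, of z]
    by (simp only: interval_measure_continuous_df(2)[OF phi])
qed (use tail_bounds clamped_eta_bounds tail_discont in auto)

lemma flux_integrable: "integrable (interval_measure \<phi>) (\<lambda>y. clamped_eta (\<phi> y) * tail (x - y))"
  by (rule M.integrable_const_bound[where B=1]) (auto simp: flux_product_bounds)

lemma flux_bounds: "0 \<le> flux \<phi> x" "flux \<phi> x \<le> 1"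
proof -
  show "0 \<le> flux \<phi> x" unfolding flux_def
    by (intro integral_nonneg_AE AE_I2 flux_product_bounds)
  show "flux \<phi> x \<le> 1" unfolding flux_def
    by (intro M.integral_le_const flux_integrable AE_I2 flux_product_bounds)
qed

lemma ennreal_flux: "ennreal (flux \<phi> x) = (\<integral>\<^sup>+y. ennreal (clamped_eta (\<phi> y)) * ennreal (tail (x - y)) \<partial>interval_measure \<phi>)"
  unfolding flux_def
  by (subst nn_integral_eq_integral[OF flux_integrable, symmetric])
    (auto simp: flux_product_bounds ennreal_mult clamped_eta_bounds tail_bounds)

lemma flux_measurable[measurable]: "flux \<phi> \<in> borel_measurable borel"
  using flux_isCont by (intro borel_measurable_continuous_onI continuous_at_imp_continuous_on) auto

lemma eta_pushforward: "(\<integral>\<^sup>+y. ennreal (clamped_eta (\<phi> y)) * indicator {..x} y \<partial>interval_measure \<phi>) = ennreal (H (\<phi> x))"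
proof -
  have "(\<integral>\<^sup>+y. ennreal (clamped_eta (cdf (interval_measure \<phi>) y)) * indicator {..x} y \<partial>interval_measure \<phi>)
    = (\<integral>\<^sup>+w. ennreal (clamped_eta w) * indicator {0<..<1} w * indicator {..cdf (interval_measure \<phi>) x} w \<partial>lborel)"
    by (rule M.nn_integral_comp_cdf) (simp_all add: interval_measure_continuous_df(2)[OF phi] continuous_dfD(2)[OF phi])
  then show ?thesis
    by (simp add: interval_measure_continuous_df(2)[OF phi] nn_integral_clamped_eta phi_bounds)
qed

text \<open>
  This identity links the model with the fixed-point equation. After exchanging the integrals twice,
  the inner integral of \<open>\<eta> (\<phi> y)\<close> over \<open>y \<le> x - z\<close> is \<open>H (\<phi> (x - z))\<close>, and the remaining weight is the
  tail of the jump law.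
\<close>

lemma nn_integral_flux:
  "(\<integral>\<^sup>+s. ennreal (flux \<phi> s) * indicator {..x} s \<partial>lborel) = ennreal (mean * eta_mass * N.evolve h \<phi> x)"
proof -
  let ?M = "interval_measure \<phi>"
  interpret pair_sigma_finite lborel ?M ..
  define e where "e y = ennreal (clamped_eta (\<phi> y))" for y
  define t where "t z = ennreal (tail z)" for z
  define i where "i s = (indicator {..x} s :: ennreal)" for s
  have [measurable]: "e \<in> borel_measurable borel" "t \<in> borel_measurable borel" "i \<in> borel_measurable borel"
    unfolding e_def t_def i_def by measurable
  have "(\<integral>\<^sup>+s. ennreal (flux \<phi> s) * indicator {..x} s \<partial>lborel) = (\<integral>\<^sup>+s. (\<integral>\<^sup>+y. e y * t (s - y) * i s \<partial>?M) \<partial>lborel)"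
    unfolding ennreal_flux e_def t_def i_def
    by (intro nn_integral_cong nn_integral_multc[symmetric]) measurable
  also have "\<dots> = (\<integral>\<^sup>+y. (\<integral>\<^sup>+s. e y * t (s - y) * i s \<partial>lborel) \<partial>?M)"
    by (rule Fubini'[symmetric]) measurable
  also have "\<dots> = (\<integral>\<^sup>+y. (\<integral>\<^sup>+z. e y * t z * i (z + y) \<partial>lborel) \<partial>?M)"
  proof (rule nn_integral_cong)
    fix y
    have "(\<integral>\<^sup>+s. e y * t (s - y) * i s \<partial>lborel) = (\<integral>\<^sup>+z. e y * t (y + 1 * z - y) * i (y + 1 * z) \<partial>lborel)"
      by (subst nn_integral_real_affine[where c=1 and t=y]) simp_all
    then show "(\<integral>\<^sup>+s. e y * t (s - y) * i s \<partial>lborel) = (\<integral>\<^sup>+z. e y * t z * i (z + y) \<partial>lborel)"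
      by (simp add: add.commute)
  qed
  also have "\<dots> = (\<integral>\<^sup>+z. (\<integral>\<^sup>+y. e y * t z * i (z + y) \<partial>?M) \<partial>lborel)"
    by (rule Fubini') measurable
  also have "\<dots> = (\<integral>\<^sup>+z. t z * ennreal (H (\<phi> (x - z))) \<partial>lborel)"
  proof (rule nn_integral_cong)
    fix z
    have "(\<integral>\<^sup>+y. e y * t z * i (z + y) \<partial>?M) = (\<integral>\<^sup>+y. t z * (ennreal (clamped_eta (\<phi> y)) * indicator {..x - z} y) \<partial>?M)"
      by (intro nn_integral_cong) (auto simp: e_def i_def mult.commute split: split_indicator)
    also have "\<dots> = t z * ennreal (H (\<phi> (x - z)))"
      by (subst nn_integral_cmult) (simp_all add: eta_pushforward)
    finally show "(\<integral>\<^sup>+y. e y * t z * i (z + y) \<partial>?M) = t z * ennreal (H (\<phi> (x - z)))" .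
  qed
  also have "\<dots> = (\<integral>\<^sup>+z. t z * (ennreal eta_mass * ennreal (h (\<phi> (x - z)))) \<partial>lborel)"
    using eta_mass_pos monostable_range[OF monostable_h phi_bounds]
    by (intro nn_integral_cong) (simp add: ennreal_mult[symmetric] h_def)
  also have "\<dots> = ennreal mean * (\<integral>\<^sup>+z. ennreal eta_mass * ennreal (h (\<phi> (x - z))) \<partial>N)"
  proof -
    have [measurable]: "(\<lambda>z. h (\<phi> (x - z))) \<in> borel_measurable borel"
      using N.evolve_integrable[OF monostable_h continuous_dfD(1)[OF phi], of x, THEN borel_measurable_integrable]
      by simp
    show ?thesis unfolding t_def by (rule nn_integral_N[symmetric]) measurable
  qed
  also have "(\<integral>\<^sup>+z. ennreal eta_mass * ennreal (h (\<phi> (x - z))) \<partial>N) = ennreal eta_mass * ennreal (N.evolve h \<phi> x)"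
    unfolding N.evolve_def
    using N.evolve_integrable[OF monostable_h continuous_dfD(1)[OF phi], of x] monostable_range[OF monostable_h phi_bounds]
    by (subst nn_integral_cmult) (auto simp: nn_integral_eq_integral)
  finally show ?thesis
    using J_mean eta_mass_pos unit_monoD(2)[OF N.evolve_unit_mono[OF monostable_h continuous_dfD(1)[OF phi]], of x]
    by (simp add: ennreal_mult mult.assoc)
qed

text \<open>
  By \<open>nn_integral_flux\<close> a fixed point is, up to a constant factor, the integral of its flux, which is
  continuous.
\<close>

lemma fixed_point_derivative:
  assumes fp: "\<And>x. N.evolve h \<phi> x = \<phi> x"
  shows "(\<phi> has_real_derivative flux \<phi> x / (mean * eta_mass)) (at x)"
proof -
  define k where "k = mean * eta_mass"
  have k: "k > 0" using J_mean eta_mass_pos by (simp add: k_def)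
  have cont: "continuous_on S (flux \<phi>)" for S
    using flux_isCont by (intro continuous_at_imp_continuous_on) auto
  have ftc: "integral {a..b} (flux \<phi>) = k * \<phi> b - k * \<phi> a" if "a \<le> b" for a b
  proof -
    have int: "flux \<phi> integrable_on {a..b}" by (rule integrable_continuous_real[OF cont])
    have nn: "0 \<le> integral {a..b} (flux \<phi>)"
      by (rule Henstock_Kurzweil_Integration.integral_nonneg[OF int]) (rule flux_bounds)
    have "((\<lambda>s. if s \<in> {a..b} then flux \<phi> s else 0) has_integral integral {a..b} (flux \<phi>)) UNIV"
      unfolding has_integral_restrict_UNIV using int by (rule integrable_integral)
    then have 1: "(\<integral>\<^sup>+s. ennreal (if s \<in> {a..b} then flux \<phi> s else 0) \<partial>lborel) = ennreal (integral {a..b} (flux \<phi>))"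
      by (intro nn_integral_has_integral_lborel) (auto simp: flux_bounds)
    have "ennreal (k * \<phi> b) = (\<integral>\<^sup>+s. ennreal (flux \<phi> s) * indicator {..b} s \<partial>lborel)"
      by (simp add: nn_integral_flux fp k_def)
    also have "\<dots> = (\<integral>\<^sup>+s. ennreal (flux \<phi> s) * indicator {..a} s + ennreal (if s \<in> {a..b} then flux \<phi> s else 0) \<partial>lborel)"
      by (rule nn_integral_cong_AE)
        (use AE_lborel_singleton[of a] in eventually_elim, use that in \<open>auto simp: indicator_def\<close>)
    also have "\<dots> = (\<integral>\<^sup>+s. ennreal (flux \<phi> s) * indicator {..a} s \<partial>lborel)
        + (\<integral>\<^sup>+s. ennreal (if s \<in> {a..b} then flux \<phi> s else 0) \<partial>lborel)"
      by (rule nn_integral_add) measurable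
    also have "\<dots> = ennreal (k * \<phi> a) + ennreal (integral {a..b} (flux \<phi>))"
      unfolding 1 nn_integral_flux fp k_def ..
    also have "\<dots> = ennreal (k * \<phi> a + integral {a..b} (flux \<phi>))"
      using k phi_bounds nn by (intro ennreal_plus[symmetric]) auto
    finally have "k * \<phi> b = k * \<phi> a + integral {a..b} (flux \<phi>)"
      using k phi_bounds nn by (subst (asm) ennreal_inj) auto
    then show ?thesis by simp
  qed
  have "((\<lambda>s. integral {x - 1..s} (flux \<phi>)) has_real_derivative flux \<phi> x) (at x within {x - 1..x + 1})"
    by (rule integral_has_real_derivative[OF cont]) auto
  then have "((\<lambda>s. integral {x - 1..s} (flux \<phi>)) has_real_derivative flux \<phi> x) (at x)"
    by (simp add: at_within_Icc_at)
  then have "((\<lambda>s. \<phi> (x - 1) + integral {x - 1..s} (flux \<phi>) / k) has_real_derivative flux \<phi> x / k) (at x)"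
    using k by (auto intro!: derivative_eq_intros)
  then show ?thesis
    unfolding k_def[symmetric]
  proof (rule has_field_derivative_transform_within_open)
    show "open {x - 1<..}" "x \<in> {x - 1<..}" by auto
    show "\<phi> (x - 1) + integral {x - 1..s} (flux \<phi>) / k = \<phi> s" if "s \<in> {x - 1<..}" for s
      using ftc[of "x - 1" s] that k by (simp add: field_simps)
  qed
qed

text \<open>
  Almost everywhere the density of \<open>\<phi>\<close> is the left derivative, hence a multiple of the flux. Integrating the
  density recovers \<open>\<phi>\<close>, and integrating the flux gives the evolved function.
\<close>

lemma fixed_point_if_left_derivative:
  assumes lip: "\<And>x y. \<bar>\<phi> x - \<phi> y\<bar> \<le> K * \<bar>x - y\<bar>"
    and left: "\<And>x d. ((\<lambda>s. (\<phi> x - \<phi> (x - s)) / s) \<longlongrightarrow> d) (at_right 0) \<Longrightarrow> d = flux \<phi> x / (mean * eta_mass)"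
  shows "N.evolve h \<phi> x = \<phi> x"
proof -
  let ?M = "interval_measure \<phi>"
  define k where "k = mean * eta_mass"
  have k: "k > 0" using J_mean eta_mass_pos by (simp add: k_def)
  note cdf = interval_measure_continuous_df(2)[OF phi]
  have "\<exists>p. p \<in> borel_measurable borel \<and> (\<forall>x. 0 \<le> p x) \<and> ?M = density lborel (\<lambda>x. ennreal (p x)) \<and>
    (AE x in lborel. ((\<lambda>s. (cdf ?M (- x) - cdf ?M (- x - s)) / s) \<longlongrightarrow> p (- x)) (at_right 0))"
    by (rule M.lipschitz_cdf_density) (simp only: cdf, rule lip)
  then obtain p where p[measurable]: "p \<in> borel_measurable borel" "\<And>x. 0 \<le> p x" "?M = density lborel (\<lambda>x. ennreal (p x))"
    and ae: "AE x in lborel. ((\<lambda>s. (\<phi> (- x) - \<phi> (- x - s)) / s) \<longlongrightarrow> p (- x)) (at_right 0)"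
    unfolding cdf by blast
  have ae': "AE x in lborel. p (- x) = flux \<phi> (- x) / k"
    using ae unfolding k_def by eventually_elim (rule left)
  have "ennreal (\<phi> x) = emeasure ?M {..x}"
    using fun_cong[OF cdf, of x] by (simp add: M.emeasure_eq_measure cdf_def)
  also have "\<dots> = (\<integral>\<^sup>+s. ennreal (p s) * indicator {..x} s \<partial>lborel)"
    by (subst p(3)) (simp add: emeasure_density)
  also have "\<dots> = (\<integral>\<^sup>+s. ennreal (p (- s)) * indicator {..x} (- s) \<partial>lborel)"
    by (subst nn_integral_real_affine[where c="-1" and t=0]) simp_all
  also have "\<dots> = (\<integral>\<^sup>+s. ennreal (flux \<phi> (- s) / k) * indicator {..x} (- s) \<partial>lborel)"
    by (rule nn_integral_cong_AE) (use ae' in eventually_elim, simp)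
  also have "\<dots> = (\<integral>\<^sup>+s. ennreal (flux \<phi> s / k) * indicator {..x} s \<partial>lborel)"
    by (subst (2) nn_integral_real_affine[where c="-1" and t=0]) simp_all
  also have "\<dots> = (\<integral>\<^sup>+s. ennreal (1 / k) * (ennreal (flux \<phi> s) * indicator {..x} s) \<partial>lborel)"
    using k flux_bounds by (intro nn_integral_cong) (simp add: mult.assoc[symmetric] ennreal_mult[symmetric])
  also have "\<dots> = ennreal (1 / k) * ennreal (k * N.evolve h \<phi> x)"
    by (subst nn_integral_cmult) (simp_all add: nn_integral_flux k_def)
  also have "\<dots> = ennreal (N.evolve h \<phi> x)"
    using k unit_monoD(2)[OF N.evolve_unit_mono[OF monostable_h continuous_dfD(1)[OF phi]], of x]
    by (subst ennreal_mult[symmetric]) auto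
  finally show ?thesis
    using phi_bounds unit_monoD(2)[OF N.evolve_unit_mono[OF monostable_h continuous_dfD(1)[OF phi]], of x]
    by (subst (asm) ennreal_inj) auto
qed

end

lemma traveling_wave_if_fixed_point:
  assumes "\<mu> > 0" and phi: "continuous_df \<phi>" and fp: "\<And>x. N.evolve h \<phi> x = \<phi> x"
  shows "traveling_wave_shape \<mu> \<eta> J \<phi>"
proof -
  define k where "k = mean * eta_mass"
  have k: "k > 0" using J_mean eta_mass_pos by (simp add: k_def)
  define v where "v = wave_speed \<mu> \<eta> J"
  have v: "v = \<mu> * k" by (simp add: v_def wave_speed_def k_def)
  have v0: "v > 0" using k \<open>\<mu> > 0\<close> by (simp add: v)
  note deriv = fixed_point_derivative[OF phi fp, folded k_def]
  have lip: "\<bar>\<phi> x - \<phi> y\<bar> \<le> 1 / k * \<bar>x - y\<bar>" for x y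
  proof -
    have "norm (\<phi> x - \<phi> y) \<le> 1 / k * norm (x - y)"
    proof (rule field_differentiable_bound)
      show "(\<phi> has_field_derivative flux \<phi> z / k) (at z within UNIV)" for z using deriv by simp
      show "norm (flux \<phi> z / k) \<le> 1 / k" for z
        using flux_bounds[OF phi, of z] k by (simp add: divide_right_mono)
    qed auto
    then show ?thesis by simp
  qed
  \<comment> \<open>Translates of a fixed point are fixed points, so their fluxes are determined by their derivatives.\<close>
  have flux_shift: "flux (\<lambda>y. \<phi> (y - a)) x = flux \<phi> (x - a)" for a x
  proof -
    have "((\<lambda>y. \<phi> (y - a)) has_real_derivative flux (\<lambda>y. \<phi> (y - a)) x / k) (at x)"
    proof (unfold k_def, rule fixed_point_derivative[OF continuous_df_shift[OF phi]])
      show "N.evolve h (\<lambda>y. \<phi> (y - a)) x = \<phi> (x - a)" for x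
        using fp[of "x - a"] by (simp add: N.evolve_def algebra_simps)
    qed
    moreover have "((\<lambda>y. \<phi> (y - a)) has_real_derivative flux \<phi> (x - a) / k * (1 - 0)) (at x)"
      by (rule DERIV_chain2[OF deriv]) (auto intro!: derivative_eq_intros)
    ultimately show ?thesis using DERIV_unique k by fastforce
  qed
  have "mean_field_model \<mu> \<eta> J (\<lambda>x t. \<phi> (x - v * t))"
    unfolding mean_field_model_def
  proof (intro conjI allI impI exI[of _ "v / k"])
    show "distribution_function (\<lambda>x. \<phi> (x - v * t))" for t
      by (intro continuous_df_distribution_function continuous_df_shift phi)
    show "antimono_on {0..} (\<lambda>t. \<phi> (x - v * t))" for x
      using v0 by (intro monotone_onI monoD[OF unit_monoD(1)[OF continuous_dfD(1)[OF phi]]]) simp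
    show "(v / k)-lipschitz_on {0..} (\<lambda>t. \<phi> (x - v * t))" for x
    proof (rule lipschitz_onI)
      fix s t :: real
      have "\<bar>\<phi> (x - v * s) - \<phi> (x - v * t)\<bar> \<le> 1 / k * \<bar>(x - v * s) - (x - v * t)\<bar>" by (rule lip)
      also have "(x - v * s) - (x - v * t) = v * (t - s)" by (simp add: algebra_simps)
      also have "1 / k * \<bar>v * (t - s)\<bar> = v / k * \<bar>s - t\<bar>" using v0 by (simp add: abs_mult abs_minus_commute)
      finally show "dist (\<phi> (x - v * s)) (\<phi> (x - v * t)) \<le> v / k * dist s t" by (simp add: dist_real_def)
    qed (use v0 k in simp)
  next
    fix x t D :: real
    \<comment> \<open>Derivatives within \<open>[0, \<infinity>)\<close> are unique because they restrict to right derivatives.\<close>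
    assume "0 \<le> t" and D: "((\<lambda>t. \<phi> (x - v * t)) has_real_derivative D) (at t within {0..})"
    have "((\<lambda>t. \<phi> (x - v * t)) has_real_derivative flux \<phi> (x - v * t) / k * (0 - v * 1)) (at t)"
      by (rule DERIV_chain2[OF deriv]) (auto intro!: derivative_eq_intros)
    then have "((\<lambda>t. \<phi> (x - v * t)) has_real_derivative flux \<phi> (x - v * t) / k * (0 - v * 1)) (at_right t)"
      by (rule has_field_derivative_at_within)
    moreover have "((\<lambda>t. \<phi> (x - v * t)) has_real_derivative D) (at_right t)"
      by (rule DERIV_subset[OF D]) (use \<open>0 \<le> t\<close> in auto)
    ultimately have "D = flux \<phi> (x - v * t) / k * (0 - v * 1)"
      unfolding has_field_derivative_iff by (intro tendsto_unique[OF trivial_limit_at_right_real])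
    also have "\<dots> = - \<mu> * flux \<phi> (x - v * t)" using k by (simp add: v)
    also have "flux \<phi> (x - v * t) = flux (\<lambda>y. \<phi> (y - v * t)) x" by (rule flux_shift[symmetric])
    finally show "D = - \<mu> * (LINT y:{..x}|interval_measure (\<lambda>y. \<phi> (y - v * t)).
        eta_bar \<eta> y (\<lambda>x. \<phi> (x - v * t)) * (1 - J (x - y)))"
      by (simp only: flux_eq[OF continuous_df_shift[OF phi]])
  qed
  then show ?thesis
    unfolding traveling_wave_shape_def v_def
    by (intro conjI continuous_df_distribution_function phi)
qed

text \<open>
  The Lipschitz bound in time, divided by the speed, is a Lipschitz bound in space. A left derivative of
  the shape is, up to the factor \<open>- v\<close>, a time derivative of the model at time 0.
\<close>

lemma fixed_point_if_traveling_wave: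
  assumes "\<mu> > 0" and wave: "traveling_wave_shape \<mu> \<eta> J \<phi>"
  shows "continuous_df \<phi>" "N.evolve h \<phi> x = \<phi> x"
proof -
  define k where "k = mean * eta_mass"
  have k: "k > 0" using J_mean eta_mass_pos by (simp add: k_def)
  define v where "v = wave_speed \<mu> \<eta> J"
  have v: "v = \<mu> * k" by (simp add: v_def wave_speed_def k_def)
  have v0: "v > 0" using k \<open>\<mu> > 0\<close> by (simp add: v)
  have df: "distribution_function \<phi>" and mfm: "mean_field_model \<mu> \<eta> J (\<lambda>x t. \<phi> (x - v * t))"
    using wave unfolding traveling_wave_shape_def v_def by blast+
  obtain c where c: "\<And>x. c-lipschitz_on {0..} (\<lambda>t. \<phi> (x - v * t))"
    using mfm unfolding mean_field_model_def by blast
  have lip': "\<bar>\<phi> x - \<phi> y\<bar> \<le> c / v * \<bar>x - y\<bar>" if "y \<le> x" for x y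
  proof -
    have "dist (\<phi> (x - v * 0)) (\<phi> (x - v * ((x - y) / v))) \<le> c * dist 0 ((x - y) / v)"
      using that v0 by (intro lipschitz_onD[OF c]) auto
    then show ?thesis using that v0 by (simp add: dist_real_def)
  qed
  have lip: "\<bar>\<phi> x - \<phi> y\<bar> \<le> c / v * \<bar>x - y\<bar>" for x y
    using lip'[of x y] lip'[of y x] by (cases "y \<le> x") (simp_all add: abs_minus_commute)
  have "isCont \<phi> x" for x by (rule isCont_if_lipschitz[OF lip])
  then show phi: "continuous_df \<phi>"
    using df unfolding continuous_df_def distribution_function_def unit_mono_def
    by simp
  show "N.evolve h \<phi> x = \<phi> x"
  proof (rule fixed_point_if_left_derivative[OF phi lip])
    fix x d assume d: "((\<lambda>s. (\<phi> x - \<phi> (x - s)) / s) \<longlongrightarrow> d) (at_right 0)"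
    have "filterlim (\<lambda>t. v * t) (at_right 0) (at_right 0)"
    proof -
      have "((\<lambda>t. v * t) \<longlongrightarrow> v * 0) (at_right 0)" by (intro tendsto_intros)
      moreover have "\<forall>\<^sub>F t in at_right 0. v * t \<in> {0<..} \<and> v * t \<noteq> 0"
        using v0 by (auto simp: eventually_at_filter)
      ultimately show ?thesis by (simp add: filterlim_at)
    qed
    from filterlim_compose[OF d this]
    have "((\<lambda>t. - v * ((\<phi> x - \<phi> (x - v * t)) / (v * t))) \<longlongrightarrow> - v * d) (at_right 0)"
      by (intro tendsto_intros)
    moreover have "- v * ((\<phi> x - \<phi> (x - v * t)) / (v * t)) = (\<phi> (x - v * t) - \<phi> (x - v * 0)) / (t - 0)" for t
      using v0 by (cases "t = 0") (simp_all add: field_simps)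
    ultimately have "((\<lambda>t. (\<phi> (x - v * t) - \<phi> (x - v * 0)) / (t - 0)) \<longlongrightarrow> - v * d) (at_right 0)"
      by (simp only:)
    then have "((\<lambda>t. \<phi> (x - v * t)) has_real_derivative - v * d) (at_right 0)"
      unfolding has_field_derivative_iff .
    then have "((\<lambda>t. \<phi> (x - v * t)) has_real_derivative - v * d) (at 0 within {0..})"
      by (simp add: at_within_Ici_at_right)
    then have "- v * d = - \<mu> * (LINT y:{..x}|interval_measure (\<lambda>y. \<phi> (y - v * 0)).
        eta_bar \<eta> y (\<lambda>x. \<phi> (x - v * 0)) * (1 - J (x - y)))"
      using mfm unfolding mean_field_model_def by blast
    then have "v * d = \<mu> * flux \<phi> x" by (simp add: flux_eq[OF phi])
    then have "k * d = flux \<phi> x" using \<open>\<mu> > 0\<close> by (simp add: v)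
    then show "d = flux \<phi> x / (mean * eta_mass)" unfolding k_def[symmetric] using k by (simp add: field_simps)
  qed
qed

lemma traveling_wave_exists:
  assumes "\<mu> > 0"
  shows "\<exists>\<phi>. traveling_wave_shape \<mu> \<eta> J \<phi>"
proof -
  obtain g where g: "unit_mono g" "\<And>x. N.evolve h g x = g x" "g 0 = 1 / 2"
    using N.fixed_point_exists[OF monostable_h star_shaped_h] by blast
  have "N.evolve h g = g" using g(2) by auto
  then have "isCont g x" for x using N.evolve_isCont[OF monostable_h g(1), of x] by simp
  then have "continuous_df g"
    using N.fixed_point_limits[OF monostable_h g(1,2), of 0 0] g(1,3) by (simp add: continuous_df_def)
  then show ?thesis using traveling_wave_if_fixed_point[OF assms _ g(2)] by blast
qed

text \<open>
  Beyond \<open>x1\<close> on the left and \<open>x0\<close> on the right the two tail estimates apply; between them \<open>\<bar>y\<bar>\<close> is bounded.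
\<close>

lemma fixed_point_moment:
  assumes phi: "continuous_df \<phi>" and fp: "\<And>x. N.evolve h \<phi> x = \<phi> x"
    and mom: "\<forall>k\<in>{1..Suc (Suc m)}. has_moment J k"
  shows "integrable (interval_measure \<phi>) (\<lambda>y. \<bar>y\<bar> ^ Suc m)"
proof -
  let ?M = "interval_measure \<phi>"
  interpret M: cdf_distribution ?M by (rule interval_measure_continuous_df[OF phi])
  have cdf: "cdf ?M x = \<phi> x" for x by (simp add: interval_measure_continuous_df(2)[OF phi])
  note real = M.real_distribution_axioms
  obtain a \<rho> x1 where "a > 0" "\<rho> > 1" "\<And>j. \<phi> (x1 - real j * a) \<le> (1 / \<rho>) ^ j"
    using N.left_tail_geometric[OF monostable_h star_shaped_h continuous_dfD(1)[OF phi] fp continuous_dfD(3)[OF phi]] by blast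
  from left_moment[OF real cdf this]
  have left: "(\<integral>\<^sup>+y. ennreal (\<bar>y\<bar> ^ Suc m) * indicator {..x1} y \<partial>?M) < \<infinity>" .
  obtain x0 where "(\<integral>\<^sup>+x. ennreal ((1 + x) ^ m) * indicator {0..} x * ennreal (1 - \<phi> (x0 + x)) \<partial>lborel) < \<infinity>"
    using N.right_tail[OF monostable_h h_flat_at_1 continuous_dfD(1)[OF phi] fp continuous_dfD(4)[OF phi] nn_integral_weight_N[OF mom]]
    by blast
  from right_moment[OF real cdf this]
  have right: "(\<integral>\<^sup>+y. ennreal (\<bar>y\<bar> ^ Suc m) * indicator {x0..} y \<partial>?M) < \<infinity>" .
  define B where "B = (\<bar>x0\<bar> + \<bar>x1\<bar>) ^ Suc m"
  have "(\<integral>\<^sup>+y. ennreal (\<bar>y\<bar> ^ Suc m) \<partial>?M) \<le> (\<integral>\<^sup>+y. ennreal (\<bar>y\<bar> ^ Suc m) * indicator {..x1} y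
      + (ennreal (\<bar>y\<bar> ^ Suc m) * indicator {x0..} y + ennreal B) \<partial>?M)"
  proof (rule nn_integral_mono)
    fix y
    show "ennreal (\<bar>y\<bar> ^ Suc m) \<le> ennreal (\<bar>y\<bar> ^ Suc m) * indicator {..x1} y
      + (ennreal (\<bar>y\<bar> ^ Suc m) * indicator {x0..} y + ennreal B)"
    proof (cases "x1 < y \<and> y < x0")
      case True
      then have "\<bar>y\<bar> ^ Suc m \<le> B" unfolding B_def by (intro power_mono) auto
      then have "ennreal (\<bar>y\<bar> ^ Suc m) \<le> ennreal B" by (rule ennreal_leI)
      then show ?thesis using True by simp
    next
      case False
      then consider "y \<le> x1" | "x0 \<le> y" by linarith
      then show ?thesis
      proof cases
        case 1
        then show ?thesis by (simp del: power_Suc)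
      next
        case 2
        have "ennreal (\<bar>y\<bar> ^ Suc m) \<le> ennreal (\<bar>y\<bar> ^ Suc m) + (ennreal (\<bar>y\<bar> ^ Suc m) * indicator {..x1} y + ennreal B)"
          by (simp del: power_Suc)
        with 2 show ?thesis by (simp add: ac_simps del: power_Suc)
      qed
    qed
  qed
  also have "\<dots> = (\<integral>\<^sup>+y. ennreal (\<bar>y\<bar> ^ Suc m) * indicator {..x1} y \<partial>?M)
      + ((\<integral>\<^sup>+y. ennreal (\<bar>y\<bar> ^ Suc m) * indicator {x0..} y \<partial>?M) + ennreal B)"
    using M.emeasure_space_1 by (simp add: nn_integral_add del: power_Suc)
  also have "\<dots> < \<infinity>" using left right by simp
  finally show ?thesis
    by (intro integrableI_nonneg) auto
qed

end

theorem theorem3p1: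
  fixes \<mu> :: real and \<eta> J :: "real \<Rightarrow> real" and l :: nat
  assumes "\<mu> > 0"
    and "\<eta> ` {0..1} \<subseteq> {0..1}"
    and "continuous_on {0..1} \<eta>"
    and "strict_antimono_on {0..1} \<eta>"
    and "\<eta> 0 = 1" and "\<eta> 1 = 0"
    and "cdf_on_nonneg J"
    and "l \<ge> 2"
    and "\<forall>k\<in>{1..l}. has_moment J k"
    and "moment J 1 > 0"
  shows "(\<exists>\<phi>. traveling_wave_shape \<mu> \<eta> J \<phi>) \<and>
         (\<forall>\<phi>. traveling_wave_shape \<mu> \<eta> J \<phi> \<longrightarrow>
            integrable (interval_measure \<phi>) (\<lambda>y. \<bar>y\<bar> ^ (l - 1)))"
proof -
  interpret wave_data \<eta> J
    using assms by unfold_locales auto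
  obtain m where l: "l = Suc (Suc m)" using \<open>l \<ge> 2\<close> by (metis add_2_eq_Suc le_Suc_ex)
  show ?thesis
  proof (intro conjI allI impI)
    show "\<exists>\<phi>. traveling_wave_shape \<mu> \<eta> J \<phi>" by (rule traveling_wave_exists[OF \<open>\<mu> > 0\<close>])
    fix \<phi> assume wave: "traveling_wave_shape \<mu> \<eta> J \<phi>"
    have "integrable (interval_measure \<phi>) (\<lambda>y. \<bar>y\<bar> ^ Suc m)"
      using fixed_point_if_traveling_wave[OF \<open>\<mu> > 0\<close> wave] assms(9) unfolding l by (rule fixed_point_moment)
    then show "integrable (interval_measure \<phi>) (\<lambda>y. \<bar>y\<bar> ^ (l - 1))" by (simp add: l)
  qed
qed

end
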